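(* Let $\{X_t\}_{t\in\mathbb Z}$ be a strictly stationary functional time series with values in $L^2([0,1],\mathbb R)$, $\mathbb E\|X_0\|_2^2<\infty$ and $\sum_{t\in\mathbb Z}\|r_t\|_2<\infty$, where $r_t$ is the autocovariance kernel at lag $t$. Let $\mathcal F_\omega$ be its spectral density operator at frequency $\omega$, and let $\widetilde{\mathcal F}$ be the integral operator with kernel $\tilde f=\frac1{2\pi}\int_{-\pi}^{\pi}f_\omega\,d\omega$, where $f_\omega$ is the spectral density kernel. Suppose that $\mathcal F:L^2([0,1],\mathbb R)\to L^2([0,1],\mathbb C)$ is a Hilbert-Schmidt operator and put $$M^2(\mathcal F)=\int_{-\pi}^{\pi}|||\mathcal F_\omega-\mathcal F|||_2^2\,d\omega .$$ Then $$M^2(\mathcal F)=\int_{-\pi}^\pi|||\mathcal F_{\omega}-\widetilde{\mathcal F}|||_2^2\,d\omega+\int_{-\pi}^\pi|||\widetilde{\mathcal F}-\mathcal F|||_2^2\,d\omega .$$ In particular, $M^2(\mathcal F)$ is minimized (over all Hilbert-Schmidt operators $\mathcal F:L^2([0,1],\mathbb R)\to L^2([0,1],\mathbb C)$) at $\mathcal F=\widetilde{\mathcal F}$.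
   Context: $\|\cdot\|_2$ is the norm of $L^2([0,1]^k)$. With $\mu(\tau)=\mathbb E X_0(\tau)$, the autocovariance kernel at lag $t$ is $r_t(\tau,\sigma)=\mathbb E[(X_{t+s}(\tau)-\mu(\tau))(X_s(\sigma)-\mu(\sigma))]$ (independent of $s$ by stationarity), an element of $L^2([0,1]^2,\mathbb R)$. The spectral density kernel is $f_\omega=\frac1{2\pi}\sum_{t\in\mathbb Z}e^{-i\omega t}r_t$, with convergence in $L^2([0,1]^2,\mathbb C)$. The spectral density operator $\mathcal F_\omega:L^2([0,1],\mathbb R)\to L^2([0,1],\mathbb C)$ is $\mathcal F_\omega h(\tau)=\int_0^1 f_\omega(\tau,\sigma)h(\sigma)\,d\sigma$, and $\widetilde{\mathcal F}h(\tau)=\int_0^1\tilde f(\tau,\sigma)h(\sigma)\,d\sigma$. For a Hilbert-Schmidt operator $A$ with kernel $k_A\in L^2([0,1]^2,\mathbb C)$, $|||A|||_2$ denotes the Hilbert-Schmidt norm, $|||A|||_2^2=\sum_i\|Ae_i\|^2=\int_0^1\int_0^1|k_A(x,y)|^2\,dx\,dy$ for any orthonormal basis $\{e_i\}$. *)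

theory Defs
  imports "HOL-Probability.Probability"
begin

section \<open>The Hilbert spaces \<open>L\<^sup>2([0,1]\<^sup>k)\<close>\<close>

text \<open>
  The type \<open>('a, 'b) L2\<close> is \<open>L\<^sup>2(Q, 'b)\<close> modulo equality almost everywhere, where \<open>Q\<close> is the unit
  cube of the Euclidean space \<open>'a\<close>. So \<open>(real, real) L2\<close> is \<open>L\<^sup>2([0,1], \<real>)\<close> and
  \<open>(real \<times> real, complex) L2\<close> is \<open>L\<^sup>2([0,1]\<^sup>2, \<complex>)\<close>. Representatives are Borel functions; every
  class of Lebesgue measurable functions contains one.
\<close>

definition unit_cube :: "'a::euclidean_space measure"
  where "unit_cube = restrict_space lborel (cbox 0 One)"

definition square_integrable :: "('a::euclidean_space \<Rightarrow> 'b::euclidean_space) \<Rightarrow> bool"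
  where "square_integrable f \<longleftrightarrow>
    f \<in> borel_measurable unit_cube \<and> integrable unit_cube (\<lambda>x. (norm (f x))\<^sup>2)"

lemma square_integrable_measurable [measurable_dest]:
  "square_integrable f \<Longrightarrow> f \<in> borel_measurable unit_cube"
  by (simp add: square_integrable_def)

lemma square_integrable_0: "square_integrable (\<lambda>x. 0)"
  by (simp add: square_integrable_def)

lemma square_integrable_scaleR:
  "square_integrable f \<Longrightarrow> square_integrable (\<lambda>x. c *\<^sub>R f x)"
  by (auto simp: square_integrable_def power_mult_distrib)

lemma square_integrable_add:
  assumes f: "square_integrable f" and g: "square_integrable g"
  shows "square_integrable (\<lambda>x. f x + g x)"
  unfolding square_integrable_def
proof (intro conjI)
  have [measurable]: "f \<in> borel_measurable unit_cube" "g \<in> borel_measurable unit_cube"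
    using f g by (auto simp: square_integrable_def)
  show "(\<lambda>x. f x + g x) \<in> borel_measurable unit_cube" by measurable
  show "integrable unit_cube (\<lambda>x. (norm (f x + g x))\<^sup>2)"
  proof (rule Bochner_Integration.integrable_bound)
    show "integrable unit_cube (\<lambda>x. 2 * (norm (f x))\<^sup>2 + 2 * (norm (g x))\<^sup>2)"
      using f g by (auto simp: square_integrable_def)
    have "(norm (f x + g x))\<^sup>2 \<le> 2 * (norm (f x))\<^sup>2 + 2 * (norm (g x))\<^sup>2" for x
    proof -
      have "(norm (f x + g x))\<^sup>2 \<le> (norm (f x) + norm (g x))\<^sup>2"
        by (intro power_mono norm_triangle_ineq) auto
      also have "\<dots> \<le> 2 * (norm (f x))\<^sup>2 + 2 * (norm (g x))\<^sup>2"
        using sum_squares_bound[of "norm (f x)" "norm (g x)"] by (simp add: power2_sum)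
      finally show ?thesis .
    qed
    then show "AE x in unit_cube. norm ((norm (f x + g x))\<^sup>2)
        \<le> norm (2 * (norm (f x))\<^sup>2 + 2 * (norm (g x))\<^sup>2)" by auto
  qed measurable
qed

lemma square_integrable_uminus: "square_integrable f \<Longrightarrow> square_integrable (\<lambda>x. - f x)"
  using square_integrable_scaleR[of f "-1"] by simp

lemma square_integrable_diff:
  "square_integrable f \<Longrightarrow> square_integrable g \<Longrightarrow> square_integrable (\<lambda>x. f x - g x)"
  using square_integrable_add[of f "\<lambda>x. - g x"] square_integrable_uminus[of g] by simp

lemma square_integrable_inner:
  assumes f: "square_integrable f" and g: "square_integrable g"
  shows "integrable unit_cube (\<lambda>x. f x \<bullet> g x)"
proof (rule Bochner_Integration.integrable_bound)
  have [measurable]: "f \<in> borel_measurable unit_cube" "g \<in> borel_measurable unit_cube"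
    using f g by (auto simp: square_integrable_def)
  show "(\<lambda>x. f x \<bullet> g x) \<in> borel_measurable unit_cube" by measurable
  show "integrable unit_cube (\<lambda>x. (norm (f x))\<^sup>2 + (norm (g x))\<^sup>2)"
    using f g by (auto simp: square_integrable_def)
  have "\<bar>f x \<bullet> g x\<bar> \<le> (norm (f x))\<^sup>2 + (norm (g x))\<^sup>2" for x
    using Cauchy_Schwarz_ineq2[of "f x" "g x"] sum_squares_bound[of "norm (f x)" "norm (g x)"]
      mult_nonneg_nonneg[OF norm_ge_zero[of "f x"] norm_ge_zero[of "g x"]] by linarith
  then show "AE x in unit_cube. norm (f x \<bullet> g x) \<le> norm ((norm (f x))\<^sup>2 + (norm (g x))\<^sup>2)"
    by auto
qed

definition L2_rel :: "('a::euclidean_space \<Rightarrow> 'b::euclidean_space) \<Rightarrow> ('a \<Rightarrow> 'b) \<Rightarrow> bool"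
  where "L2_rel f g \<longleftrightarrow>
    square_integrable f \<and> square_integrable g \<and> (AE x in unit_cube. f x = g x)"

lemma part_equivp_L2_rel:
  "part_equivp (L2_rel :: ('a::euclidean_space \<Rightarrow> 'b::euclidean_space) \<Rightarrow> _)"
proof (rule part_equivpI)
  show "\<exists>f :: 'a \<Rightarrow> 'b. L2_rel f f"
    using square_integrable_0 by (auto simp: L2_rel_def)
  show "symp (L2_rel :: ('a \<Rightarrow> 'b) \<Rightarrow> _)"
    by (auto simp: L2_rel_def symp_def eq_commute)
  show "transp (L2_rel :: ('a \<Rightarrow> 'b) \<Rightarrow> _)"
  proof (rule transpI)
    fix f g h :: "'a \<Rightarrow> 'b"
    assume *: "L2_rel f g" "L2_rel g h"
    then have "AE x in unit_cube. f x = g x" "AE x in unit_cube. g x = h x"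
      by (auto simp: L2_rel_def)
    then have "AE x in unit_cube. f x = h x" by eventually_elim simp
    with * show "L2_rel f h" by (auto simp: L2_rel_def)
  qed
qed

quotient_type (overloaded) ('a, 'b) L2 =
    "'a::euclidean_space \<Rightarrow> 'b::euclidean_space" / partial: L2_rel
  by (rule part_equivp_L2_rel)

instantiation L2 :: (euclidean_space, euclidean_space) real_vector
begin

lift_definition zero_L2 :: "('a, 'b) L2" is "\<lambda>x. 0"
  by (simp add: L2_rel_def square_integrable_0)

lift_definition plus_L2 :: "('a, 'b) L2 \<Rightarrow> ('a, 'b) L2 \<Rightarrow> ('a, 'b) L2" is "\<lambda>f g x. f x + g x"
  by (auto simp: L2_rel_def square_integrable_add)

lift_definition minus_L2 :: "('a, 'b) L2 \<Rightarrow> ('a, 'b) L2 \<Rightarrow> ('a, 'b) L2" is "\<lambda>f g x. f x - g x"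
  by (auto simp: L2_rel_def square_integrable_diff)

lift_definition uminus_L2 :: "('a, 'b) L2 \<Rightarrow> ('a, 'b) L2" is "\<lambda>f x. - f x"
  by (auto simp: L2_rel_def square_integrable_uminus)

lift_definition scaleR_L2 :: "real \<Rightarrow> ('a, 'b) L2 \<Rightarrow> ('a, 'b) L2" is "\<lambda>c f x. c *\<^sub>R f x"
  by (auto simp: L2_rel_def square_integrable_scaleR)

instance
proof
  fix f g h :: "('a, 'b) L2" and a b :: real
  show "f + g + h = f + (g + h)"
    by transfer (auto simp: L2_rel_def add.assoc square_integrable_add)
  show "f + g = g + f"
    by transfer (auto simp: L2_rel_def add.commute square_integrable_add)
  show "0 + f = f" by transfer (auto simp: L2_rel_def)
  show "- f + f = 0" by transfer (auto simp: L2_rel_def square_integrable_0)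
  show "f - g = f + - g"
    by transfer (auto simp: L2_rel_def square_integrable_diff)
  show "a *\<^sub>R (f + g) = a *\<^sub>R f + a *\<^sub>R g"
    by transfer (auto simp: L2_rel_def scaleR_add_right square_integrable_add square_integrable_scaleR)
  show "(a + b) *\<^sub>R f = a *\<^sub>R f + b *\<^sub>R f"
    by transfer (auto simp: L2_rel_def scaleR_add_left square_integrable_add square_integrable_scaleR)
  show "a *\<^sub>R b *\<^sub>R f = (a * b) *\<^sub>R f"
    by transfer (auto simp: L2_rel_def square_integrable_scaleR)
  show "1 *\<^sub>R f = f" by transfer (auto simp: L2_rel_def)
qed

end

instantiation L2 :: (euclidean_space, euclidean_space) real_inner
begin

text \<open>
  For \<^typ>\<open>complex\<close>-valued functions this is the real part of the usual Hermitian inner product;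
  it induces the usual norm.
\<close>

lift_definition inner_L2 :: "('a, 'b) L2 \<Rightarrow> ('a, 'b) L2 \<Rightarrow> real"
  is "\<lambda>f g. LINT x|unit_cube. f x \<bullet> g x"
proof (rule integral_cong_AE)
  fix f f' g g' :: "'a \<Rightarrow> 'b" assume *: "L2_rel f f'" "L2_rel g g'"
  then have [measurable]: "f \<in> borel_measurable unit_cube" "g \<in> borel_measurable unit_cube"
     "f' \<in> borel_measurable unit_cube" "g' \<in> borel_measurable unit_cube"
    by (auto simp: L2_rel_def square_integrable_def)
  show "(\<lambda>x. f x \<bullet> g x) \<in> borel_measurable unit_cube"
    "(\<lambda>x. f' x \<bullet> g' x) \<in> borel_measurable unit_cube" by measurable
  show "AE x in unit_cube. f x \<bullet> g x = f' x \<bullet> g' x"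
    using * by (auto simp: L2_rel_def)
qed

lift_definition norm_L2 :: "('a, 'b) L2 \<Rightarrow> real"
  is "\<lambda>f. sqrt (LINT x|unit_cube. (norm (f x))\<^sup>2)"
proof -
  fix f f' :: "'a \<Rightarrow> 'b" assume *: "L2_rel f f'"
  then have [measurable]: "f \<in> borel_measurable unit_cube" "f' \<in> borel_measurable unit_cube"
    by (auto simp: L2_rel_def square_integrable_def)
  have "(LINT x|unit_cube. (norm (f x))\<^sup>2) = (LINT x|unit_cube. (norm (f' x))\<^sup>2)"
  proof (rule integral_cong_AE)
    show "AE x in unit_cube. (norm (f x))\<^sup>2 = (norm (f' x))\<^sup>2"
      using * by (auto simp: L2_rel_def)
  qed measurable
  then show "sqrt (LINT x|unit_cube. (norm (f x))\<^sup>2) = sqrt (LINT x|unit_cube. (norm (f' x))\<^sup>2)"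
    by simp
qed

definition dist_L2 :: "('a, 'b) L2 \<Rightarrow> ('a, 'b) L2 \<Rightarrow> real"
  where "dist_L2 f g = norm (f - g)"

definition sgn_L2 :: "('a, 'b) L2 \<Rightarrow> ('a, 'b) L2"
  where "sgn_L2 f = inverse (norm f) *\<^sub>R f"

definition uniformity_L2 :: "(('a, 'b) L2 \<times> ('a, 'b) L2) filter"
  where "uniformity_L2 = (INF e\<in>{0 <..}. principal {(f, g). dist f g < e})"

definition open_L2 :: "('a, 'b) L2 set \<Rightarrow> bool"
  where "open_L2 U \<longleftrightarrow> (\<forall>f\<in>U. eventually (\<lambda>(f', g). f' = f \<longrightarrow> g \<in> U) uniformity)"

instance
proof
  fix f g h :: "('a, 'b) L2" and a :: real
  show "dist f g = norm (f - g)" by (simp add: dist_L2_def)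
  show "sgn f = f /\<^sub>R norm f" by (simp add: sgn_L2_def)
  show "uniformity = (INF e\<in>{0 <..}. principal {(f, g :: ('a, 'b) L2). dist f g < e})"
    by (simp add: uniformity_L2_def)
  show "open U \<longleftrightarrow> (\<forall>f\<in>U. \<forall>\<^sub>F (f', g) in uniformity. f' = f \<longrightarrow> g \<in> U)" for U :: "('a, 'b) L2 set"
    by (simp add: open_L2_def)
  show "f \<bullet> g = g \<bullet> f" by transfer (simp add: inner_commute)
  show "(f + g) \<bullet> h = f \<bullet> h + g \<bullet> h"
    by transfer (simp add: L2_rel_def inner_add_left square_integrable_inner)
  show "a *\<^sub>R f \<bullet> g = a * (f \<bullet> g)" by transfer simp
  show "0 \<le> f \<bullet> f" by transfer (simp add: integral_nonneg_AE)
  show "norm f = sqrt (f \<bullet> f)" by transfer (simp add: power2_norm_eq_inner)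
  show "f \<bullet> f = 0 \<longleftrightarrow> f = 0"
  proof transfer
    fix f :: "'a \<Rightarrow> 'b" assume f: "L2_rel f f"
    have "(LINT x|unit_cube. f x \<bullet> f x) = 0 \<longleftrightarrow> (AE x in unit_cube. f x \<bullet> f x = 0)"
      using f by (intro integral_nonneg_eq_0_iff_AE square_integrable_inner) (auto simp: L2_rel_def)
    then show "(LINT x|unit_cube. f x \<bullet> f x) = 0 \<longleftrightarrow> L2_rel f (\<lambda>x. 0)"
      using f by (simp add: L2_rel_def square_integrable_0)
  qed
qed

end

lift_definition cscale :: "complex \<Rightarrow> ('a::euclidean_space, real) L2 \<Rightarrow> ('a, complex) L2"
  is "\<lambda>c f x. c * complex_of_real (f x)"
  by (auto simp: L2_rel_def square_integrable_def norm_mult power_mult_distrib)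

lemma cbox_One_prod:
  "cbox 0 (One :: 'a::euclidean_space \<times> 'b::euclidean_space) = cbox 0 One \<times> cbox 0 One"
proof -
  have "(One :: 'a \<times> 'b) = (One, One)"
  proof (rule euclidean_eqI)
    fix b :: "'a \<times> 'b" assume b: "b \<in> Basis"
    then have "One \<bullet> b = 1"
      using inner_sum_left_Basis[of b "\<lambda>_. 1"] by simp
    moreover from b consider i where "b = (i, 0)" "i \<in> Basis" | i where "b = (0, i)" "i \<in> Basis"
      by (auto simp: Basis_prod_def)
    then have "(One, One) \<bullet> b = 1"
      by cases simp_all
    ultimately show "One \<bullet> b = (One, One) \<bullet> b" by simp
  qed
  then show ?thesis
    by (simp add: zero_prod_def cbox_Pair_eq)
qed

lemma finite_measure_unit_cube: "finite_measure (unit_cube :: 'a::euclidean_space measure)"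
  unfolding unit_cube_def
  by (rule finite_measureI) (simp add: emeasure_restrict_space emeasure_lborel_cbox_finite less_top)

lemma sets_unit_cube: "A \<in> sets unit_cube \<longleftrightarrow> A \<in> sets borel \<and> A \<subseteq> cbox 0 One"
  by (auto simp: unit_cube_def sets_restrict_space_iff)

lemma space_unit_cube: "space unit_cube = cbox 0 One"
  by (simp add: unit_cube_def space_restrict_space)

lemma emeasure_unit_cube: "S \<subseteq> cbox 0 One \<Longrightarrow> emeasure unit_cube S = emeasure lborel S"
  unfolding unit_cube_def by (intro emeasure_restrict_space) auto

lemma unit_cube_prod:
  "(unit_cube :: 'a::euclidean_space measure) \<Otimes>\<^sub>M (unit_cube :: 'b::euclidean_space measure) =
    unit_cube"
proof (rule pair_measure_eqI)
  show "sigma_finite_measure (unit_cube :: 'a measure)"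
    "sigma_finite_measure (unit_cube :: 'b measure)"
    by (rule finite_measure.axioms(1)[OF finite_measure_unit_cube])+
  show "sets ((unit_cube :: 'a measure) \<Otimes>\<^sub>M (unit_cube :: 'b measure)) =
      sets (unit_cube :: ('a \<times> 'b) measure)"
  proof (intro antisym subsetI)
    fix S :: "('a \<times> 'b) set" assume S: "S \<in> sets unit_cube"
    have "(\<lambda>x. x) \<in> measurable (unit_cube :: 'a measure) borel"
      "(\<lambda>x. x) \<in> measurable (unit_cube :: 'b measure) borel"
      by (auto simp: unit_cube_def intro!: measurable_restrict_space1)
    then have "(\<lambda>z. (fst z, snd z)) \<in>
        measurable ((unit_cube :: 'a measure) \<Otimes>\<^sub>M (unit_cube :: 'b measure)) (borel \<Otimes>\<^sub>M borel)"
      by (intro measurable_Pair measurable_compose[OF measurable_fst]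
          measurable_compose[OF measurable_snd])
    moreover have "S \<in> sets (borel \<Otimes>\<^sub>M borel)" "S \<subseteq> cbox 0 One \<times> cbox 0 One"
      using S unfolding borel_prod by (auto simp: sets_unit_cube cbox_One_prod)
    ultimately have "(\<lambda>z. (fst z, snd z)) -` S \<inter> (cbox 0 One \<times> cbox 0 One) \<in>
        sets ((unit_cube :: 'a measure) \<Otimes>\<^sub>M (unit_cube :: 'b measure))"
      by (auto dest!: measurable_sets simp: space_pair_measure space_unit_cube)
    with \<open>S \<subseteq> _\<close> show "S \<in> sets ((unit_cube :: 'a measure) \<Otimes>\<^sub>M (unit_cube :: 'b measure))"
      by (simp add: Int_absorb2)
  next
    have "sets ((unit_cube :: 'a measure) \<Otimes>\<^sub>M (unit_cube :: 'b measure)) \<subseteq>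
        sets (unit_cube :: ('a \<times> 'b) measure)"
      by (rule sets_pair_in_sets)
        (auto simp: sets_unit_cube space_unit_cube cbox_One_prod intro!: borel_Times)
    then show "S \<in> sets (unit_cube :: ('a \<times> 'b) measure)"
      if "S \<in> sets ((unit_cube :: 'a measure) \<Otimes>\<^sub>M (unit_cube :: 'b measure))" for S
      using that by (rule subsetD)
  qed
next
  fix A :: "'a set" and B :: "'b set"
  assume "A \<in> sets unit_cube" "B \<in> sets unit_cube"
  then have AB: "A \<in> sets borel" "B \<in> sets borel" "A \<subseteq> cbox 0 One" "B \<subseteq> cbox 0 One"
    by (auto simp: sets_unit_cube)
  have sub: "A \<times> B \<subseteq> cbox 0 One"
    unfolding cbox_One_prod using AB(3,4) by (rule Sigma_mono)
  have "emeasure (lborel :: ('a \<times> 'b) measure) (A \<times> B) = emeasure lborel A * emeasure lborel B"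
    using AB by (subst lborel_prod[symmetric]) (simp add: lborel.emeasure_pair_measure_Times)
  then show "emeasure unit_cube A * emeasure unit_cube B = emeasure unit_cube (A \<times> B)"
    by (simp only: emeasure_unit_cube[OF AB(3)] emeasure_unit_cube[OF AB(4)] emeasure_unit_cube[OF sub])
qed

lemma pair_sigma_finite_unit_cube:
  "pair_sigma_finite (unit_cube :: 'a::euclidean_space measure)
    (unit_cube :: 'b::euclidean_space measure)"
  by (rule pair_sigma_finite.intro) (rule finite_measure.axioms(1)[OF finite_measure_unit_cube])+

lemma square_integrable_section:
  fixes k :: "'a::euclidean_space \<times> 'b::euclidean_space \<Rightarrow> 'c::euclidean_space"
  assumes "square_integrable k"
  shows "AE x in unit_cube. square_integrable (\<lambda>y. k (x, y))"
proof -
  have [measurable]: "k \<in> borel_measurable (unit_cube \<Otimes>\<^sub>M unit_cube)"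
    and int: "integrable (unit_cube \<Otimes>\<^sub>M unit_cube) (\<lambda>x. (norm (k x))\<^sup>2)"
    using assms by (simp_all add: square_integrable_def unit_cube_prod)
  have "AE x in unit_cube. integrable unit_cube (\<lambda>y. (norm (k (x, y)))\<^sup>2)"
    by (rule pair_sigma_finite.AE_integrable_fst'[OF pair_sigma_finite_unit_cube int])
  then show ?thesis
    using AE_space
  proof eventually_elim
    case (elim x)
    have "(\<lambda>y. k (x, y)) \<in> borel_measurable unit_cube"
      using elim(2) by measurable
    with elim(1) show ?case by (simp add: square_integrable_def)
  qed
qed

lemma Cauchy_Schwarz_square_integrable:
  fixes f :: "'a::euclidean_space \<Rightarrow> complex" and h :: "'a \<Rightarrow> real"
  assumes f: "square_integrable f" and h: "square_integrable h"
  shows "(norm (LINT x|unit_cube. f x * complex_of_real (h x)))\<^sup>2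
    \<le> (LINT x|unit_cube. (norm (f x))\<^sup>2) * (LINT x|unit_cube. (norm (h x))\<^sup>2)"
proof -
  have [measurable]: "f \<in> borel_measurable unit_cube" "h \<in> borel_measurable unit_cube"
    using f h by (auto simp: square_integrable_def)
  have intf: "integrable unit_cube (\<lambda>x. (norm (f x))\<^sup>2)"
    and inth: "integrable unit_cube (\<lambda>x. (norm (h x))\<^sup>2)"
    using f h by (auto simp: square_integrable_def)
  have "ennreal (norm (LINT x|unit_cube. f x * complex_of_real (h x)))
      \<le> (\<integral>\<^sup>+x. ennreal (norm (f x)) * ennreal (norm (h x)) \<partial>unit_cube)"
  proof (cases "integrable unit_cube (\<lambda>x. f x * complex_of_real (h x))")
    case True
    from integral_norm_bound_ennreal[OF True] show ?thesis
      by (simp add: norm_mult ennreal_mult')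
  next
    case False
    then show ?thesis by (simp add: not_integrable_integral_eq)
  qed
  then have "(ennreal (norm (LINT x|unit_cube. f x * complex_of_real (h x))))\<^sup>2
      \<le> (\<integral>\<^sup>+x. ennreal (norm (f x)) * ennreal (norm (h x)) \<partial>unit_cube)\<^sup>2"
    by (rule power_mono) simp
  also have "\<dots> \<le> (\<integral>\<^sup>+x. (ennreal (norm (f x)))\<^sup>2 \<partial>unit_cube)
      * (\<integral>\<^sup>+x. (ennreal (norm (h x)))\<^sup>2 \<partial>unit_cube)"
    by (rule Cauchy_Schwarz_nn_integral) measurable
  also have "\<dots> = ennreal (LINT x|unit_cube. (norm (f x))\<^sup>2) * ennreal (LINT x|unit_cube. (norm (h x))\<^sup>2)"
    using nn_integral_eq_integral[OF intf] nn_integral_eq_integral[OF inth]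
    by (simp add: ennreal_power)
  also have "\<dots> = ennreal ((LINT x|unit_cube. (norm (f x))\<^sup>2) * (LINT x|unit_cube. (norm (h x))\<^sup>2))"
    by (rule ennreal_mult[symmetric]) auto
  finally show ?thesis
    by (simp add: ennreal_power)
qed

lemma square_integrable_integral_operator:
  fixes k :: "real \<times> real \<Rightarrow> complex" and h :: "real \<Rightarrow> real"
  assumes k: "square_integrable k" and h: "square_integrable h"
  shows "square_integrable (\<lambda>x. LINT y|unit_cube. k (x, y) * complex_of_real (h y))"
  unfolding square_integrable_def
proof (intro conjI)
  interpret sigma_finite_measure "unit_cube :: real measure"
    by (rule finite_measure.axioms(1)[OF finite_measure_unit_cube])
  have [measurable]: "k \<in> borel_measurable (unit_cube \<Otimes>\<^sub>M unit_cube)" "h \<in> borel_measurable unit_cube"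
    and int: "integrable (unit_cube \<Otimes>\<^sub>M unit_cube) (\<lambda>x. (norm (k x))\<^sup>2)"
    using k h by (simp_all add: square_integrable_def unit_cube_prod)
  show meas [measurable]:
    "(\<lambda>x. LINT y|unit_cube. k (x, y) * complex_of_real (h y)) \<in> borel_measurable unit_cube"
    by measurable
  show "integrable unit_cube (\<lambda>x. (norm (LINT y|unit_cube. k (x, y) * complex_of_real (h y)))\<^sup>2)"
  proof (rule Bochner_Integration.integrable_bound)
    show "integrable unit_cube (\<lambda>x. (LINT y|unit_cube. (norm (k (x, y)))\<^sup>2)
        * (LINT y|unit_cube. (norm (h y))\<^sup>2))"
      using pair_sigma_finite.integrable_fst'[OF pair_sigma_finite_unit_cube int] by simp
    show "AE x in unit_cube. norm ((norm (LINT y|unit_cube. k (x, y) * complex_of_real (h y)))\<^sup>2)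
        \<le> norm ((LINT y|unit_cube. (norm (k (x, y)))\<^sup>2) * (LINT y|unit_cube. (norm (h y))\<^sup>2))"
      using square_integrable_section[OF k]
    proof eventually_elim
      case (elim x)
      then show ?case
        using Cauchy_Schwarz_square_integrable[OF elim h] by (simp add: abs_mult)
    qed
  qed measurable
qed

lemma integral_operator_respects:
  fixes k k' :: "real \<times> real \<Rightarrow> complex" and h h' :: "real \<Rightarrow> real"
  assumes k: "L2_rel k k'" and h: "L2_rel h h'"
  shows "L2_rel (\<lambda>x. LINT y|unit_cube. k (x, y) * complex_of_real (h y))
    (\<lambda>x. LINT y|unit_cube. k' (x, y) * complex_of_real (h' y))"
  unfolding L2_rel_def
proof (intro conjI)
  show "square_integrable (\<lambda>x. LINT y|unit_cube. k (x, y) * complex_of_real (h y))"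
    "square_integrable (\<lambda>x. LINT y|unit_cube. k' (x, y) * complex_of_real (h' y))"
    using k h by (auto simp: L2_rel_def intro!: square_integrable_integral_operator)
  have "AE z in unit_cube \<Otimes>\<^sub>M unit_cube. k z = k' z"
    using k unfolding unit_cube_prod by (simp add: L2_rel_def)
  then have "AE x in unit_cube. AE y in unit_cube. k (x, y) = k' (x, y)"
    by (rule pair_sigma_finite.AE_pair[OF pair_sigma_finite_unit_cube])
  moreover have "AE x in unit_cube. square_integrable (\<lambda>y. k (x, y))"
    "AE x in unit_cube. square_integrable (\<lambda>y. k' (x, y))"
    using k by (auto simp: L2_rel_def intro!: square_integrable_section)
  ultimately show "AE x in unit_cube. (LINT y|unit_cube. k (x, y) * complex_of_real (h y)) =
      (LINT y|unit_cube. k' (x, y) * complex_of_real (h' y))"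
  proof eventually_elim
    case (elim x)
    have [measurable]: "h \<in> borel_measurable unit_cube" "h' \<in> borel_measurable unit_cube"
      "(\<lambda>y. k (x, y)) \<in> borel_measurable unit_cube" "(\<lambda>y. k' (x, y)) \<in> borel_measurable unit_cube"
      using h elim by (auto simp: L2_rel_def square_integrable_def)
    have "AE y in unit_cube. h y = h' y"
      using h by (simp add: L2_rel_def)
    with elim(1) have "AE y in unit_cube. k (x, y) * complex_of_real (h y) = k' (x, y) * complex_of_real (h' y)"
      by eventually_elim simp
    then show ?case
      by (intro integral_cong_AE) measurable
  qed
qed

lift_definition integral_operator ::
    "(real \<times> real, complex) L2 \<Rightarrow> (real, real) L2 \<Rightarrow> (real, complex) L2"
  is "\<lambda>k h \<tau>. LINT \<sigma>|unit_cube. k (\<tau>, \<sigma>) * complex_of_real (h \<sigma>)"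
  by (rule integral_operator_respects)


section \<open>Hilbert-Schmidt operators\<close>

definition orthonormal_basis :: "'a::real_inner set \<Rightarrow> bool"
  where "orthonormal_basis B \<longleftrightarrow>
    pairwise orthogonal B \<and> (\<forall>e\<in>B. norm e = 1) \<and> closure (span B) = UNIV"

text \<open>
  Neither the summability nor the value of the sum depends on the orthonormal basis, so that any
  choice of basis gives the norm.
\<close>

definition hilbert_schmidt :: "('a::real_inner \<Rightarrow> 'b::real_inner) \<Rightarrow> bool"
  where "hilbert_schmidt A \<longleftrightarrow> bounded_linear A \<and>
    (\<forall>B. orthonormal_basis B \<longrightarrow> (\<lambda>e. (norm (A e))\<^sup>2) summable_on B)"

definition hs_norm :: "('a::real_inner \<Rightarrow> 'b::real_inner) \<Rightarrow> real"
  where "hs_norm A = sqrt (\<Sum>\<^sub>\<infinity>e\<in>(SOME B. orthonormal_basis B). (norm (A e))\<^sup>2)"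


section \<open>Functional time series\<close>

text \<open>
  The Borel \<open>\<sigma>\<close>-algebra of a finite power of the separable space \<open>L\<^sup>2\<close> is the product
  \<open>\<sigma>\<close>-algebra used here.
\<close>

definition strictly_stationary ::
    "'w measure \<Rightarrow> (int \<Rightarrow> 'w \<Rightarrow> 'b::topological_space) \<Rightarrow> bool"
  where "strictly_stationary M X \<longleftrightarrow> (\<forall>t. X t \<in> borel_measurable M) \<and>
    (\<forall>J h. finite J \<longrightarrow>
      distr M (PiM J (\<lambda>_. borel)) (\<lambda>w. \<lambda>t\<in>J. X (t + h) w) =
      distr M (PiM J (\<lambda>_. borel)) (\<lambda>w. \<lambda>t\<in>J. X t w))"

text \<open>
  \<open>X(\<tau>)\<close> for a random element \<open>X\<close> of \<open>L\<^sup>2([0,1], \<real>)\<close> is read off a jointly measurable version.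
  One exists because \<open>L\<^sup>2\<close> is separable, and any two agree almost everywhere on the product,
  so that the classes in \<open>L\<^sup>2\<close> of the moment functions below do not depend on the choice.
\<close>

definition is_version :: "'w measure \<Rightarrow> ('w \<Rightarrow> (real, real) L2) \<Rightarrow> ('w \<Rightarrow> real \<Rightarrow> real) \<Rightarrow> bool"
  where "is_version M Z Y \<longleftrightarrow>
    (\<lambda>(w, \<tau>). Y w \<tau>) \<in> borel_measurable (M \<Otimes>\<^sub>M unit_cube) \<and>
    (\<forall>w\<in>space M. square_integrable (Y w) \<and> abs_L2 (Y w) = Z w)"

definition version :: "'w measure \<Rightarrow> ('w \<Rightarrow> (real, real) L2) \<Rightarrow> 'w \<Rightarrow> real \<Rightarrow> real"
  where "version M Z = (SOME Y. is_version M Z Y)"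

definition mean_function :: "'w measure \<Rightarrow> (int \<Rightarrow> 'w \<Rightarrow> (real, real) L2) \<Rightarrow> real \<Rightarrow> real"
  where "mean_function M X \<tau> = (LINT w|M. version M (X 0) w \<tau>)"

definition autocov_function ::
    "'w measure \<Rightarrow> (int \<Rightarrow> 'w \<Rightarrow> (real, real) L2) \<Rightarrow> int \<Rightarrow> real \<times> real \<Rightarrow> real"
  where "autocov_function M X t = (\<lambda>(\<tau>, \<sigma>). LINT w|M.
    (version M (X t) w \<tau> - mean_function M X \<tau>) * (version M (X 0) w \<sigma> - mean_function M X \<sigma>))"

text \<open>
  For strictly stationary \<open>X\<close> with \<open>E \<parallel>X\<^sub>0\<parallel>\<^sup>2 < \<infinity>\<close> the autocovariance function (whose lag is measured
  from time \<open>0\<close>) is square integrable.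
\<close>

definition autocov_kernel ::
    "'w measure \<Rightarrow> (int \<Rightarrow> 'w \<Rightarrow> (real, real) L2) \<Rightarrow> int \<Rightarrow> (real \<times> real, real) L2"
  where "autocov_kernel M X t = abs_L2 (autocov_function M X t)"

definition spectral_density_kernel ::
    "'w measure \<Rightarrow> (int \<Rightarrow> 'w \<Rightarrow> (real, real) L2) \<Rightarrow> real \<Rightarrow> (real \<times> real, complex) L2"
  where "spectral_density_kernel M X \<omega> = (1 / (2 * pi)) *\<^sub>R
    (\<Sum>\<^sub>\<infinity>t\<in>UNIV. cscale (exp (- \<i> * \<omega> * of_int t)) (autocov_kernel M X t))"

definition spectral_density_operator ::
    "'w measure \<Rightarrow> (int \<Rightarrow> 'w \<Rightarrow> (real, real) L2) \<Rightarrow> real \<Rightarrow> (real, real) L2 \<Rightarrow> (real, complex) L2"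
  where "spectral_density_operator M X \<omega> = integral_operator (spectral_density_kernel M X \<omega>)"

text \<open>
  The integral over frequencies is the gauge integral of the \<open>L\<^sup>2\<close>-valued function
  \<open>\<omega> \<mapsto> f\<^sub>\<omega>\<close>, which is continuous when the autocovariance kernels are summable in norm.
\<close>

definition mean_spectral_kernel ::
    "'w measure \<Rightarrow> (int \<Rightarrow> 'w \<Rightarrow> (real, real) L2) \<Rightarrow> (real \<times> real, complex) L2"
  where "mean_spectral_kernel M X =
    (1 / (2 * pi)) *\<^sub>R integral {- pi..pi} (spectral_density_kernel M X)"

definition mean_spectral_operator ::
    "'w measure \<Rightarrow> (int \<Rightarrow> 'w \<Rightarrow> (real, real) L2) \<Rightarrow> (real, real) L2 \<Rightarrow> (real, complex) L2"
  where "mean_spectral_operator M X = integral_operator (mean_spectral_kernel M X)"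

definition integrated_hs_distance_sq :: "'w measure \<Rightarrow> (int \<Rightarrow> 'w \<Rightarrow> (real, real) L2) \<Rightarrow>
    ((real, real) L2 \<Rightarrow> (real, complex) L2) \<Rightarrow> real"
  where "integrated_hs_distance_sq M X F =
    integral {- pi..pi} (\<lambda>\<omega>. (hs_norm (\<lambda>h. spectral_density_operator M X \<omega> h - F h))\<^sup>2)"

end

theory Submission
  imports Defs
begin

text \<open>
  Fix an orthonormal basis \<open>B\<close> and use the Hilbert-Schmidt inner product \<open>\<Sum>e\<in>B. A e \<bullet> C e\<close>. Bessel's
  inequality, applied to almost every section of a kernel, bounds the Hilbert-Schmidt norm of an
  integral operator by the norm of its kernel. So pairing with a fixed Hilbert-Schmidt operator
  \<open>D = F\<^sub>m - F\<close> (\<open>F\<^sub>m\<close> the operator with the averaged kernel \<open>m\<close>) is a bounded linear functional of the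
  kernel, and commutes with integration over frequencies. As \<open>f\<^sub>\<omega>\<close> is continuous in \<open>\<omega>\<close> and \<open>f\<^sub>\<omega> - m\<close>
  integrates to \<open>0\<close>, the cross term in the expansion of \<open>\<parallel>(F\<^sub>\<omega> - F\<^sub>m) + D\<parallel>\<^sup>2\<close> integrates to \<open>0\<close>.
  Completeness of \<open>L\<^sup>2\<close> is needed for the sum and the integral of kernels to exist, and for the
  existence of an orthonormal basis.
\<close>

section \<open>Completeness of \<open>L\<^sup>2\<close>\<close>

lemma square_integrable_rep_L2: "square_integrable (rep_L2 f)"
  using Quotient_rep_reflp[OF Quotient_L2, of f] by (simp add: L2_rel_def)

lemma abs_rep_L2: "abs_L2 (rep_L2 f) = f"
  by (rule Quotient_abs_rep[OF Quotient_L2])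

lemma L2_rel_self: "square_integrable f \<Longrightarrow> L2_rel f f"
  by (simp add: L2_rel_def)

lemma norm_abs_L2_sq:
  "square_integrable f \<Longrightarrow> (norm (abs_L2 f))\<^sup>2 = (LINT x|unit_cube. (norm (f x))\<^sup>2)"
  by (simp add: norm_L2.abs_eq L2_rel_self integral_nonneg_AE)

lemma norm_L2_sq: "(norm f)\<^sup>2 = (LINT x|unit_cube. (norm (rep_L2 f x))\<^sup>2)"
  using norm_abs_L2_sq[OF square_integrable_rep_L2, of f] by (simp add: abs_rep_L2)

lemma diff_abs_L2:
  "square_integrable f \<Longrightarrow> square_integrable g \<Longrightarrow>
    abs_L2 f - abs_L2 g = abs_L2 (\<lambda>x. f x - g x)"
  by (simp add: minus_L2.abs_eq L2_rel_self)

lemma nn_integral_norm_sq: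
  assumes "square_integrable f"
  shows "(\<integral>\<^sup>+x. ennreal ((norm (f x))\<^sup>2) \<partial>unit_cube) = ennreal ((norm (abs_L2 f))\<^sup>2)"
  using assms by (simp add: norm_abs_L2_sq square_integrable_def nn_integral_eq_integral)

lemma square_integrableI_nn_integral:
  assumes "f \<in> borel_measurable unit_cube"
    and "(\<integral>\<^sup>+x. ennreal ((norm (f x))\<^sup>2) \<partial>unit_cube) < \<infinity>"
  shows "square_integrable f"
  unfolding square_integrable_def using assms by (auto intro!: integrableI_nonneg)

text \<open>Young's inequality \<open>norm y \<le> c + inverse c * (norm y)\<^sup>2\<close> with the
  weight \<open>c\<close> matched to the norm balances both terms. The cube has finite measure, so
  the resulting L1 bound is linear in \<open>c\<close> and stays summable along a geometric sequence
  of norms.\<close>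

lemma nn_integral_norm_le:
  fixes f :: "'a::euclidean_space \<Rightarrow> 'b::euclidean_space"
  assumes f: "square_integrable f" and c: "norm (abs_L2 f) \<le> c" "0 < c"
  shows "(\<integral>\<^sup>+x. ennreal (norm (f x)) \<partial>unit_cube)
    \<le> ennreal c * (emeasure unit_cube (space (unit_cube :: 'a measure)) + 1)"
proof -
  have [measurable]: "f \<in> borel_measurable unit_cube" using f by (simp add: square_integrable_def)
  have pt: "norm y \<le> c + inverse c * (norm y)\<^sup>2" for y :: 'b
  proof -
    have "c * norm y \<le> c * c + (norm y)\<^sup>2"
      using sum_squares_bound[of c "norm y"] mult_nonneg_nonneg[OF less_imp_le[OF c(2)] norm_ge_zero[of y]]
      unfolding power2_eq_square by linarith
    then have "inverse c * (c * norm y) \<le> inverse c * (c * c + (norm y)\<^sup>2)"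
      using c by (intro mult_left_mono) auto
    then show ?thesis using c by (simp add: field_simps)
  qed
  have "(\<integral>\<^sup>+x. ennreal (norm (f x)) \<partial>unit_cube)
      \<le> (\<integral>\<^sup>+x. ennreal c + ennreal (inverse c) * ennreal ((norm (f x))\<^sup>2) \<partial>unit_cube)"
  proof (rule nn_integral_mono)
    fix x :: 'a
    have "ennreal (norm (f x)) \<le> ennreal (c + inverse c * (norm (f x))\<^sup>2)"
      using pt[of "f x"] by (rule ennreal_leI)
    also have "\<dots> = ennreal c + ennreal (inverse c) * ennreal ((norm (f x))\<^sup>2)"
      using c by (simp add: ennreal_plus ennreal_mult)
    finally show "ennreal (norm (f x)) \<le> ennreal c + ennreal (inverse c) * ennreal ((norm (f x))\<^sup>2)" .
  qed
  also have "\<dots> = ennreal c * emeasure unit_cube (space (unit_cube :: 'a measure))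
      + ennreal (inverse c) * ennreal ((norm (abs_L2 f))\<^sup>2)"
    by (simp add: nn_integral_add nn_integral_cmult nn_integral_norm_sq[OF f])
  also have "ennreal (inverse c) * ennreal ((norm (abs_L2 f))\<^sup>2) \<le> ennreal c"
  proof -
    have "inverse c * (norm (abs_L2 f))\<^sup>2 \<le> inverse c * c\<^sup>2"
      using c by (intro mult_left_mono power_mono) auto
    also have "\<dots> = c" using c by (simp add: power2_eq_square)
    finally show ?thesis using c by (simp add: ennreal_mult[symmetric] ennreal_leI)
  qed
  finally show ?thesis by (simp add: distrib_left add_mono)
qed

text \<open>The Riesz-Fischer argument: the increments of the representatives have summable L1
  norms, so the representatives converge almost everywhere, and Fatou's lemma shows that the
  pointwise limit is also the limit in norm.\<close>

lemma L2_fast_Cauchy_convergent: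
  fixes X :: "nat \<Rightarrow> ('a::euclidean_space, 'b::euclidean_space) L2"
  assumes X: "\<And>m n. n \<le> m \<Longrightarrow> norm (X m - X n) \<le> (1/2)^n"
  shows "convergent X"
proof -
  interpret finite_measure "unit_cube :: 'a measure" by (rule finite_measure_unit_cube)
  define u where "u n = rep_L2 (X n)" for n
  have u: "square_integrable (u n)" for n unfolding u_def by (rule square_integrable_rep_L2)
  have au: "abs_L2 (u n) = X n" for n by (simp add: u_def abs_rep_L2)
  have [measurable]: "u n \<in> borel_measurable unit_cube" for n
    using u by (simp add: square_integrable_def)
  have nd: "norm (abs_L2 (\<lambda>x. u m x - u n x)) \<le> (1/2)^n" if "n \<le> m" for m n
    using X[OF that] by (simp add: diff_abs_L2[OF u u, symmetric] au)
  let ?C = "emeasure unit_cube (space (unit_cube :: 'a measure)) + 1"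
  have "(\<integral>\<^sup>+x. (\<Sum>n. ennreal (norm (u (Suc n) x - u n x))) \<partial>unit_cube)
      = (\<Sum>n. \<integral>\<^sup>+x. ennreal (norm (u (Suc n) x - u n x)) \<partial>unit_cube)"
    by (rule nn_integral_suminf) measurable
  also have "\<dots> \<le> (\<Sum>n. ennreal ((1/2)^n) * ?C)"
    by (intro suminf_le nn_integral_norm_le square_integrable_diff u nd) auto
  also have "\<dots> = (\<Sum>n. ennreal ((1/2)^n)) * ?C" by simp
  also have "(\<Sum>n. ennreal ((1/2)^n)) = ennreal (\<Sum>n. (1/2)^n)"
    by (rule suminf_ennreal2) (auto intro: summable_geometric)
  also have "\<dots> * ?C < \<infinity>"
    using emeasure_finite[of "space (unit_cube :: 'a measure)"] by (auto simp: less_top[symmetric] ennreal_mult_eq_top_iff)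
  finally have "AE x in unit_cube. (\<Sum>n. ennreal (norm (u (Suc n) x - u n x))) \<noteq> \<infinity>"
    by (intro nn_integral_PInf_AE) auto
  then have conv: "AE x in unit_cube. convergent (\<lambda>n. u n x)"
  proof eventually_elim
    case (elim x)
    then have "summable (\<lambda>n. norm (u (Suc n) x - u n x))"
      by (intro summable_suminf_not_top) auto
    then have "summable (\<lambda>n. u (Suc n) x - u n x)" by (rule summable_norm_cancel)
    then have "convergent (\<lambda>n. \<Sum>i<n. u (Suc i) x - u i x)"
      by (simp add: summable_iff_convergent)
    then have "convergent (\<lambda>n. u n x - u 0 x)" by (subst (asm) sum_lessThan_telescope)
    then show ?case
      using convergent_add[OF _ convergent_const[of "u 0 x"], of "\<lambda>n. u n x - u 0 x"] by simp
  qed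
  \<comment> \<open>Where the sequence diverges, \<open>lim\<close> is an unspecified value; by
    \<open>conv\<close> this happens only on a null set.\<close>
  define g where "g x = lim (\<lambda>n. u n x)" for x
  have [measurable]: "g \<in> borel_measurable unit_cube" unfolding g_def by measurable
  have bd: "(\<integral>\<^sup>+x. ennreal ((norm (g x - u n x))\<^sup>2) \<partial>unit_cube) \<le> ennreal (((1/2)^n)\<^sup>2)" for n
  proof -
    have "(\<integral>\<^sup>+x. ennreal ((norm (g x - u n x))\<^sup>2) \<partial>unit_cube)
        = (\<integral>\<^sup>+x. liminf (\<lambda>m. ennreal ((norm (u m x - u n x))\<^sup>2)) \<partial>unit_cube)"
    proof (rule nn_integral_cong_AE, use conv in eventually_elim)
      case (elim x)
      then have "(\<lambda>m. u m x) \<longlonglongrightarrow> g x" by (simp add: g_def convergent_LIMSEQ_iff)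
      then have "(\<lambda>m. ennreal ((norm (u m x - u n x))\<^sup>2)) \<longlonglongrightarrow> ennreal ((norm (g x - u n x))\<^sup>2)"
        by (intro tendsto_intros)
      then show ?case by (intro lim_imp_Liminf[symmetric]) auto
    qed
    also have "\<dots> \<le> liminf (\<lambda>m. \<integral>\<^sup>+x. ennreal ((norm (u m x - u n x))\<^sup>2) \<partial>unit_cube)"
      by (rule nn_integral_liminf) measurable
    \<comment> \<open>The norm estimate is available only for \<open>n \<le> m\<close>; the limsup
      is bounded by any eventual bound.\<close>
    also have "\<dots> \<le> limsup (\<lambda>m. \<integral>\<^sup>+x. ennreal ((norm (u m x - u n x))\<^sup>2) \<partial>unit_cube)"
      by (rule Liminf_le_Limsup) simp
    also have "\<dots> \<le> ennreal (((1/2)^n)\<^sup>2)"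
    proof (rule Limsup_bounded, rule eventually_sequentiallyI)
      fix m assume "n \<le> m"
      then show "(\<integral>\<^sup>+x. ennreal ((norm (u m x - u n x))\<^sup>2) \<partial>unit_cube) \<le> ennreal (((1/2)^n)\<^sup>2)"
        by (subst nn_integral_norm_sq[OF square_integrable_diff[OF u u]])
          (intro ennreal_leI power_mono nd, auto)
    qed
    finally show ?thesis .
  qed
  have si: "square_integrable (\<lambda>x. g x - u n x)" for n
    by (rule square_integrableI_nn_integral, measurable, rule le_less_trans[OF bd]) simp
  \<comment> \<open>Fatou controls only the differences from \<open>u n\<close>; adding
    \<open>u 0\<close> back gives \<open>g\<close> itself.\<close>
  have g: "square_integrable g"
    using square_integrable_add[OF si[of 0] u[of 0]] by simp
  have le: "norm (X n - abs_L2 g) \<le> (1/2)^n" for n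
  proof -
    have "ennreal ((norm (abs_L2 (\<lambda>x. g x - u n x)))\<^sup>2) \<le> ennreal (((1/2)^n)\<^sup>2)"
      using bd[of n] by (simp add: nn_integral_norm_sq[OF si])
    then have "(norm (abs_L2 (\<lambda>x. g x - u n x)))\<^sup>2 \<le> ((1/2)^n)\<^sup>2"
      by (subst (asm) ennreal_le_iff) auto
    then have "norm (abs_L2 (\<lambda>x. g x - u n x)) \<le> (1/2)^n"
      by (rule power2_le_imp_le) simp
    then show ?thesis
      by (simp add: diff_abs_L2[OF g u, symmetric] au norm_minus_commute)
  qed
  have "(\<lambda>n. X n - abs_L2 g) \<longlonglongrightarrow> 0"
    by (rule Lim_null_comparison[OF always_eventually LIMSEQ_realpow_zero[of "1/2"]])
      (use le in auto)
  then have "X \<longlonglongrightarrow> abs_L2 g" by (simp add: LIM_zero_iff)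
  then show ?thesis by (rule convergentI)
qed

text \<open>A Cauchy sequence has a subsequence with geometric rate, which converges by the previous
  lemma; a Cauchy sequence converges with any of its subsequences.\<close>

instance L2 :: (euclidean_space, euclidean_space) banach
proof
  fix X :: "nat \<Rightarrow> ('a, 'b) L2" assume X: "Cauchy X"
  have "\<exists>N. \<forall>m\<ge>N. \<forall>n\<ge>N. norm (X m - X n) < (1/2)^k" for k
    using CauchyD[OF X, of "(1/2)^k"] by auto
  then obtain N where N: "\<And>k m n. N k \<le> m \<Longrightarrow> N k \<le> n \<Longrightarrow> norm (X m - X n) < (1/2)^k"
    by metis
  \<comment> \<open>Partial sums dominate each \<open>N k\<close>, and the added 1 makes them
    strictly increasing.\<close>
  define r where "r k = (\<Sum>i\<le>k. N i + 1)" for k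
  have r: "strict_mono r" unfolding strict_mono_Suc_iff by (simp add: r_def)
  have Nr: "N k \<le> r k" for k unfolding r_def
    using member_le_sum[of k "{..k}" "\<lambda>i. N i + 1"] by simp
  have "norm ((X \<circ> r) m - (X \<circ> r) n) \<le> (1/2)^n" if "n \<le> m" for m n
    using N[of n "r m" "r n"] Nr[of n] strict_mono_less_eq[OF r, of n m] that by auto
  then have "convergent (X \<circ> r)" by (rule L2_fast_Cauchy_convergent)
  then obtain l where "(X \<circ> r) \<longlonglongrightarrow> l" by (auto simp: convergent_def)
  then show "convergent X" using Cauchy_converges_subseq[OF X r] by (auto intro: convergentI)
qed

section \<open>Orthonormal bases and square-summable families\<close>

lemma norm_add_sq: "(norm (x + y))\<^sup>2 = (norm x)\<^sup>2 + (norm y)\<^sup>2 + 2 * (x \<bullet> y)"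
  for x y :: "'a::real_inner"
  using dot_norm[of x y] by (simp add: field_simps)

text \<open>With \<open>p\<close> the orthogonal projection of \<open>x\<close> onto the span of
  \<open>F\<close>, the difference of the two sides is
  \<open>(norm (x - p))\<^sup>2\<close>.\<close>

lemma Bessel_inequality_finite:
  fixes x :: "'a::real_inner"
  assumes F: "finite F" "pairwise orthogonal F" "\<And>e. e \<in> F \<Longrightarrow> norm e = 1"
  shows "(\<Sum>e\<in>F. (x \<bullet> e)\<^sup>2) \<le> (norm x)\<^sup>2"
proof -
  define p where "p = (\<Sum>e\<in>F. (x \<bullet> e) *\<^sub>R e)"
  have p: "(norm p)\<^sup>2 = (\<Sum>e\<in>F. (x \<bullet> e)\<^sup>2)"
    unfolding p_def using F
    by (subst norm_sum_Pythagorean) (auto simp: pairwise_def orthogonal_clauses power_mult_distrib)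
  have "x \<bullet> p = (\<Sum>e\<in>F. (x \<bullet> e)\<^sup>2)"
    by (simp add: p_def inner_sum_right power2_eq_square)
  with p have "(norm (x - p))\<^sup>2 = (norm x)\<^sup>2 - (\<Sum>e\<in>F. (x \<bullet> e)\<^sup>2)"
    using norm_add_sq[of x "- p"] by simp
  then show ?thesis by (metis diff_ge_0_iff_ge zero_le_power2)
qed

text \<open>By Pythagoras, two nested partial sums differ in squared norm by a partial sum of the
  squares. So the net of partial sums is Cauchy, and completeness supplies its limit.\<close>

lemma summable_on_orthogonal:
  fixes f :: "'i \<Rightarrow> 'a::{real_inner, banach}"
  assumes orth: "\<And>i j. i \<in> I \<Longrightarrow> j \<in> I \<Longrightarrow> i \<noteq> j \<Longrightarrow> f i \<bullet> f j = 0"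
    and sq: "(\<lambda>i. (norm (f i))\<^sup>2) summable_on I"
  shows "f summable_on I"
proof -
  have pyth: "(norm (sum f F))\<^sup>2 = (\<Sum>i\<in>F. (norm (f i))\<^sup>2)" if "finite F" "F \<subseteq> I" for F
    using that
  proof (induction F)
    case (insert i F)
    have "f i \<bullet> sum f F = 0"
      unfolding inner_sum_right using insert orth by (intro sum.neutral) auto
    with insert show ?case
      by (simp add: norm_add_sq)
  qed simp
  define S where "S = (\<Sum>\<^sub>\<infinity>i\<in>I. (norm (f i))\<^sup>2)"
  have S: "((\<lambda>F. \<Sum>i\<in>F. (norm (f i))\<^sup>2) \<longlongrightarrow> S) (finite_subsets_at_top I)"
    using has_sum_infsum[OF sq] by (simp add: has_sum_def S_def)
  have "\<exists>P. eventually P (finite_subsets_at_top I) \<and>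
      (\<forall>F F'. P F \<and> P F' \<longrightarrow> dist (sum f F) (sum f F') < \<epsilon>)" if \<epsilon>: "\<epsilon> > 0" for \<epsilon>
  proof -
    \<comment> \<open>Two sums of squares this close to \<open>S\<close> differ by less than
      \<open>(\<epsilon>/2)\<^sup>2\<close>; hence every larger partial sum lies within
      \<open>\<epsilon>/2\<close> of the one over \<open>F0\<close>, and any two lie within
      \<open>\<epsilon>\<close> of each other.\<close>
    have "eventually (\<lambda>F. dist (\<Sum>i\<in>F. (norm (f i))\<^sup>2) S < (\<epsilon>/2)\<^sup>2 / 2) (finite_subsets_at_top I)"
      using tendstoD[OF S, of "(\<epsilon>/2)\<^sup>2 / 2"] \<epsilon> by simp
    then obtain F0 where F0: "finite F0" "F0 \<subseteq> I"
      and near: "\<And>F. finite F \<Longrightarrow> F0 \<subseteq> F \<Longrightarrow> F \<subseteq> I \<Longrightarrow>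
        dist (\<Sum>i\<in>F. (norm (f i))\<^sup>2) S < (\<epsilon>/2)\<^sup>2 / 2"
      by (auto simp only: eventually_finite_subsets_at_top)
    have half: "dist (sum f F) (sum f F0) < \<epsilon>/2" if F: "finite F" "F0 \<subseteq> F" "F \<subseteq> I" for F
    proof -
      have "sum f F - sum f F0 = sum f (F - F0)"
        using sum_diff[OF F(1,2), of f] by simp
      then have "(norm (sum f F - sum f F0))\<^sup>2 = (\<Sum>i\<in>F. (norm (f i))\<^sup>2) - (\<Sum>i\<in>F0. (norm (f i))\<^sup>2)"
        using pyth[of "F - F0"] F F0(1) by (auto simp: sum_diff)
      also have "\<dots> < (\<epsilon>/2)\<^sup>2"
        using near[OF F] near[OF F0(1) order_refl F0(2)] unfolding dist_real_def by linarith
      finally show ?thesis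
        unfolding dist_norm using \<epsilon> by (intro power2_less_imp_less[of _ "\<epsilon>/2"]) auto
    qed
    have "dist (sum f F) (sum f F') < \<epsilon>"
      if "finite F \<and> F0 \<subseteq> F \<and> F \<subseteq> I" "finite F' \<and> F0 \<subseteq> F' \<and> F' \<subseteq> I" for F F'
      using half[of F] half[of F'] that dist_triangle_half_l[of "sum f F" "sum f F0" \<epsilon> "sum f F'"]
      by (auto simp: dist_commute)
    moreover have "eventually (\<lambda>F. finite F \<and> F0 \<subseteq> F \<and> F \<subseteq> I) (finite_subsets_at_top I)"
      using F0 unfolding eventually_finite_subsets_at_top by (intro exI[of _ F0]) simp
    ultimately show ?thesis by (intro exI[of _ "\<lambda>F. finite F \<and> F0 \<subseteq> F \<and> F \<subseteq> I"]) simp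
  qed
  then have "cauchy_filter (filtermap (sum f) (finite_subsets_at_top I))"
    by (simp add: cauchy_filter_metric_filtermap)
  then obtain L where "(sum f \<longlongrightarrow> L) (finite_subsets_at_top I)"
    using complete_UNIV complete_uniform[where S="UNIV :: 'a set"] by (force simp: filterlim_def)
  then show ?thesis by (auto simp: summable_on_def has_sum_def)
qed

text \<open>Zorn's lemma gives a maximal orthonormal set \<open>B\<close>. Bessel's inequality makes
  the Fourier series of \<open>x\<close> over \<open>B\<close> converge to some \<open>y\<close>;
  the remainder \<open>x - y\<close> is orthogonal to \<open>B\<close>, so it vanishes by
  maximality. This ensures that the basis chosen in \<open>hs_norm\<close> really is one.\<close>

lemma orthonormal_basis_exists:
  "\<exists>B :: 'a::{real_inner, banach} set. orthonormal_basis B"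
proof -
  define \<A> :: "'a set set" where "\<A> = {B. pairwise orthogonal B \<and> (\<forall>e\<in>B. norm e = 1)}"
  have "\<exists>B\<in>\<A>. \<forall>B'\<in>\<A>. B \<subseteq> B' \<longrightarrow> B' = B"
  proof (rule subset_Zorn')
    fix C assume C: "subset.chain \<A> C"
    then have "C \<subseteq> \<A>" and "chain\<^sub>\<subseteq> C"
      by (auto simp: subset_chain_def chain_subset_def)
    moreover from this have "pairwise orthogonal (\<Union>C)"
      by (intro pairwise_chain_Union) (auto simp: \<A>_def)
    ultimately show "\<Union>C \<in> \<A>" by (auto simp: \<A>_def)
  qed
  then obtain B where B: "pairwise orthogonal B" "\<And>e. e \<in> B \<Longrightarrow> norm e = 1"
    and max: "\<And>B'. B' \<in> \<A> \<Longrightarrow> B \<subseteq> B' \<Longrightarrow> B' = B"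
    by (auto simp: \<A>_def)
  have "x \<in> closure (span B)" for x
  proof -
    have bes: "(\<Sum>e\<in>F. (x \<bullet> e)\<^sup>2) \<le> (norm x)\<^sup>2" if "finite F" "F \<subseteq> B" for F
      using that B by (intro Bessel_inequality_finite) (auto intro: pairwise_subset)
    have "(\<lambda>e. (x \<bullet> e)\<^sup>2) summable_on B"
    proof (rule nonneg_bdd_above_summable_on)
      show "bdd_above (sum (\<lambda>e. (x \<bullet> e)\<^sup>2) ` {F. F \<subseteq> B \<and> finite F})"
        using bes by (intro bdd_aboveI2) auto
    qed simp
    moreover have "(norm ((x \<bullet> e) *\<^sub>R e))\<^sup>2 = (x \<bullet> e)\<^sup>2" if "e \<in> B" for e
      using B(2)[OF that] by simp
    ultimately have "(\<lambda>e. (norm ((x \<bullet> e) *\<^sub>R e))\<^sup>2) summable_on B"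
      by (simp cong: summable_on_cong)
    then have sm: "(\<lambda>e. (x \<bullet> e) *\<^sub>R e) summable_on B"
    proof (rule summable_on_orthogonal[rotated])
      fix e e' assume "e \<in> B" "e' \<in> B" "e \<noteq> e'"
      then show "((x \<bullet> e) *\<^sub>R e) \<bullet> ((x \<bullet> e') *\<^sub>R e') = 0"
        using pairwiseD[OF B(1), of e e'] by (simp add: orthogonal_def)
    qed
    define y where "y = (\<Sum>\<^sub>\<infinity>e\<in>B. (x \<bullet> e) *\<^sub>R e)"
    have hs: "((\<lambda>e. (x \<bullet> e) *\<^sub>R e) has_sum y) B" unfolding y_def using sm by (rule has_sum_infsum)
    have y: "y \<in> closure (span B)"
    proof (rule Lim_in_closed_set[OF closed_closure])
      show "\<forall>\<^sub>F F in finite_subsets_at_top B. (\<Sum>e\<in>F. (x \<bullet> e) *\<^sub>R e) \<in> closure (span B)"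
      proof (rule eventually_finite_subsets_at_top_weakI)
        fix F assume "F \<subseteq> B"
        then have "(\<Sum>e\<in>F. (x \<bullet> e) *\<^sub>R e) \<in> span B"
          by (intro span_sum span_scale span_base) auto
        then show "(\<Sum>e\<in>F. (x \<bullet> e) *\<^sub>R e) \<in> closure (span B)"
          using closure_subset by blast
      qed
      show "((\<lambda>F. \<Sum>e\<in>F. (x \<bullet> e) *\<^sub>R e) \<longlongrightarrow> y) (finite_subsets_at_top B)"
        using hs by (simp add: has_sum_def)
    qed simp
    have "(x - y) \<bullet> e = 0" if e: "e \<in> B" for e
    proof -
      \<comment> \<open>Pairing with \<open>e\<close> is continuous and passes under the sum, where
        orthogonality leaves only the term of \<open>e\<close>.\<close>
      have "((\<lambda>e'. ((x \<bullet> e') *\<^sub>R e') \<bullet> e) has_sum (y \<bullet> e)) B"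
        using has_sum_bounded_linear[OF bounded_linear_inner_left hs] by (simp add: o_def)
      moreover have "((\<lambda>e'. ((x \<bullet> e') *\<^sub>R e') \<bullet> e) has_sum (\<Sum>e'\<in>{e}. ((x \<bullet> e') *\<^sub>R e') \<bullet> e)) B"
      proof (rule has_sum_finite_neutralI)
        fix e' assume "e' \<in> B - {e}"
        then show "((x \<bullet> e') *\<^sub>R e') \<bullet> e = 0"
          using pairwiseD[OF B(1), of e' e] e by (simp add: orthogonal_def)
      qed (use e in auto)
      ultimately have "y \<bullet> e = (\<Sum>e'\<in>{e}. ((x \<bullet> e') *\<^sub>R e') \<bullet> e)" by (rule has_sum_unique)
      also have "\<dots> = x \<bullet> e" using B(2)[OF e] by (simp add: norm_eq_1)
      finally show ?thesis by (simp add: inner_diff_left)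
    qed
    then have perp: "(x - y) \<bullet> e = 0" "e \<bullet> (x - y) = 0" if "e \<in> B" for e
      using that by (auto simp: inner_commute)
    have "x = y"
    proof (rule ccontr)
      assume ne: "x \<noteq> y"
      define z where "z = sgn (x - y)"
      have "norm z = 1" using ne by (simp add: z_def norm_sgn)
      moreover have "orthogonal z e \<and> orthogonal e z" if "e \<in> B" for e
        using perp[OF that] by (simp add: z_def sgn_div_norm orthogonal_def)
      \<comment> \<open>The normalized remainder extends \<open>B\<close>, so maximality puts it
        into \<open>B\<close>. It is then orthogonal to \<open>x - y\<close>, although it is a
        positive multiple of that nonzero vector.\<close>
      ultimately have "insert z B \<in> \<A>"
        using B by (simp add: \<A>_def pairwise_insert)
      then have "z \<in> B" using max[of "insert z B"] by auto
      from perp(1)[OF this] have "(x - y) \<bullet> z = 0" .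
      then show False using ne by (simp add: z_def sgn_div_norm)
    qed
    with y show ?thesis by simp
  qed
  with B have "orthonormal_basis B" by (auto simp: orthonormal_basis_def)
  then show ?thesis ..
qed

section \<open>Inner products of square-summable families\<close>

lemma summable_on_inner:
  fixes A C :: "'i \<Rightarrow> 'b::real_inner"
  assumes A: "(\<lambda>e. (norm (A e))\<^sup>2) summable_on B" and C: "(\<lambda>e. (norm (C e))\<^sup>2) summable_on B"
  shows "(\<lambda>e. A e \<bullet> C e) summable_on B"
proof -
  have "(\<lambda>e. norm (A e \<bullet> C e)) summable_on B"
  proof (rule summable_on_comparison_test[OF summable_on_add[OF A C]])
    fix e
    show "norm (A e \<bullet> C e) \<le> (norm (A e))\<^sup>2 + (norm (C e))\<^sup>2"
      using Cauchy_Schwarz_ineq2[of "A e" "C e"] sum_squares_bound[of "norm (A e)" "norm (C e)"]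
        mult_nonneg_nonneg[OF norm_ge_zero[of "A e"] norm_ge_zero[of "C e"]]
      unfolding real_norm_def by linarith
  qed simp
  then show ?thesis by (rule abs_summable_summable)
qed

text \<open>Cauchy-Schwarz is used twice on each finite subset, in the target space and for the
  finite sums of norms; the bound does not depend on the subset and survives the limit.\<close>

lemma infsum_inner_le:
  fixes A C :: "'i \<Rightarrow> 'b::real_inner"
  assumes A: "(\<lambda>e. (norm (A e))\<^sup>2) summable_on B" and C: "(\<lambda>e. (norm (C e))\<^sup>2) summable_on B"
  shows "\<bar>\<Sum>\<^sub>\<infinity>e\<in>B. A e \<bullet> C e\<bar>
    \<le> sqrt (\<Sum>\<^sub>\<infinity>e\<in>B. (norm (A e))\<^sup>2) * sqrt (\<Sum>\<^sub>\<infinity>e\<in>B. (norm (C e))\<^sup>2)" (is "_ \<le> ?R")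
proof -
  have s: "(\<lambda>e. A e \<bullet> C e) summable_on B" using A C by (rule summable_on_inner)
  have fin: "\<bar>\<Sum>e\<in>F. A e \<bullet> C e\<bar> \<le> ?R" if F: "finite F" "F \<subseteq> B" for F
  proof -
    have "\<bar>\<Sum>e\<in>F. A e \<bullet> C e\<bar> \<le> (\<Sum>e\<in>F. \<bar>norm (A e)\<bar> * \<bar>norm (C e)\<bar>)"
      by (rule order_trans[OF sum_abs sum_mono]) (simp add: Cauchy_Schwarz_ineq2)
    also have "\<dots> \<le> L2_set (\<lambda>e. norm (A e)) F * L2_set (\<lambda>e. norm (C e)) F"
      by (rule L2_set_mult_ineq)
    also have "\<dots> \<le> ?R" unfolding L2_set_def
      using F A C by (intro mult_mono real_sqrt_le_mono finite_sum_le_infsum)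
        (auto intro: infsum_nonneg sum_nonneg)
    finally show ?thesis .
  qed
  have "((\<lambda>F. \<Sum>e\<in>F. A e \<bullet> C e) \<longlongrightarrow> (\<Sum>\<^sub>\<infinity>e\<in>B. A e \<bullet> C e)) (finite_subsets_at_top B)"
    using has_sum_infsum[OF s] by (simp add: has_sum_def)
  then have "((\<lambda>F. \<bar>\<Sum>e\<in>F. A e \<bullet> C e\<bar>) \<longlongrightarrow> \<bar>\<Sum>\<^sub>\<infinity>e\<in>B. A e \<bullet> C e\<bar>) (finite_subsets_at_top B)"
    by (rule tendsto_rabs)
  then show ?thesis
    by (rule tendsto_upperbound) (rule eventually_finite_subsets_at_top_weakI, erule (1) fin, simp)
qed

lemma summable_on_norm_add_sq:
  fixes A C :: "'i \<Rightarrow> 'b::real_inner"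
  assumes A: "(\<lambda>e. (norm (A e))\<^sup>2) summable_on B" and C: "(\<lambda>e. (norm (C e))\<^sup>2) summable_on B"
  shows "(\<lambda>e. (norm (A e + C e))\<^sup>2) summable_on B"
  unfolding norm_add_sq
  by (rule summable_on_add[OF summable_on_add[OF A C] summable_on_cmult_right[OF summable_on_inner[OF A C]]])

lemma infsum_norm_add_sq:
  fixes A C :: "'i \<Rightarrow> 'b::real_inner"
  assumes A: "(\<lambda>e. (norm (A e))\<^sup>2) summable_on B" and C: "(\<lambda>e. (norm (C e))\<^sup>2) summable_on B"
  shows "(\<Sum>\<^sub>\<infinity>e\<in>B. (norm (A e + C e))\<^sup>2) = (\<Sum>\<^sub>\<infinity>e\<in>B. (norm (A e))\<^sup>2)
    + (\<Sum>\<^sub>\<infinity>e\<in>B. (norm (C e))\<^sup>2) + 2 * (\<Sum>\<^sub>\<infinity>e\<in>B. A e \<bullet> C e)"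
proof -
  note AC = summable_on_inner[OF A C]
  show ?thesis
    unfolding norm_add_sq infsum_add[OF summable_on_add[OF A C] summable_on_cmult_right[OF AC]]
      infsum_add[OF A C] by (simp only: infsum_cmult_right[OF AC])
qed

section \<open>Integral operators\<close>

lemma integrable_mult_of_real:
  fixes f :: "'a::euclidean_space \<Rightarrow> complex" and h :: "'a \<Rightarrow> real"
  assumes f: "square_integrable f" and h: "square_integrable h"
  shows "integrable unit_cube (\<lambda>x. f x * complex_of_real (h x))"
proof (rule Bochner_Integration.integrable_bound)
  have [measurable]: "f \<in> borel_measurable unit_cube" "h \<in> borel_measurable unit_cube"
    using f h by (auto simp: square_integrable_def)
  show "(\<lambda>x. f x * complex_of_real (h x)) \<in> borel_measurable unit_cube" by measurable
  show "integrable unit_cube (\<lambda>x. (norm (f x))\<^sup>2 + (norm (h x))\<^sup>2)"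
    using f h by (auto simp: square_integrable_def)
  have "norm (f x * complex_of_real (h x)) \<le> (norm (f x))\<^sup>2 + (norm (h x))\<^sup>2" for x
    using sum_squares_bound[of "norm (f x)" "norm (h x)"]
      mult_nonneg_nonneg[OF norm_ge_zero[of "f x"] norm_ge_zero[of "h x"]]
    unfolding norm_mult norm_of_real real_norm_def by linarith
  then show "AE x in unit_cube. norm (f x * complex_of_real (h x))
      \<le> norm ((norm (f x))\<^sup>2 + (norm (h x))\<^sup>2)" by simp
qed

lemma square_integrable_Re_Im:
  fixes f :: "'a::euclidean_space \<Rightarrow> complex"
  assumes f: "square_integrable f"
  shows "square_integrable (\<lambda>x. Re (f x))" "square_integrable (\<lambda>x. Im (f x))"
proof -
  have [measurable]: "f \<in> borel_measurable unit_cube" using f by (simp add: square_integrable_def)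
  have i: "integrable unit_cube (\<lambda>x. (norm (f x))\<^sup>2)" using f by (simp add: square_integrable_def)
  have "integrable unit_cube (\<lambda>x. (norm (Re (f x)))\<^sup>2)"
    by (rule Bochner_Integration.integrable_bound[OF i]) (auto simp: cmod_power2)
  then show "square_integrable (\<lambda>x. Re (f x))" by (simp add: square_integrable_def)
  have "integrable unit_cube (\<lambda>x. (norm (Im (f x)))\<^sup>2)"
    by (rule Bochner_Integration.integrable_bound[OF i]) (auto simp: cmod_power2)
  then show "square_integrable (\<lambda>x. Im (f x))" by (simp add: square_integrable_def)
qed

lemma inner_abs_L2:
  "square_integrable f \<Longrightarrow> abs_L2 f \<bullet> h = (LINT x|unit_cube. f x \<bullet> rep_L2 h x)"
  using inner_L2.abs_eq[OF L2_rel_self L2_rel_self, of f "rep_L2 h"]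
  by (simp add: abs_rep_L2 square_integrable_rep_L2)

text \<open>As \<open>h\<close> is real-valued, the real and imaginary parts of the integral are
  themselves inner products with \<open>h\<close> in a real L2 space. This puts the values of an
  integral operator within reach of Bessel's inequality there.\<close>

lemma norm_integral_mult_of_real:
  fixes f :: "'a::euclidean_space \<Rightarrow> complex" and h :: "('a, real) L2"
  assumes f: "square_integrable f"
  shows "(norm (LINT x|unit_cube. f x * complex_of_real (rep_L2 h x)))\<^sup>2
    = (abs_L2 (\<lambda>x. Re (f x)) \<bullet> h)\<^sup>2 + (abs_L2 (\<lambda>x. Im (f x)) \<bullet> h)\<^sup>2"
proof -
  have i: "integrable unit_cube (\<lambda>x. f x * complex_of_real (rep_L2 h x))"
    by (intro integrable_mult_of_real f square_integrable_rep_L2)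
  show ?thesis
    unfolding cmod_power2 integral_Re[OF i, symmetric] integral_Im[OF i, symmetric]
      inner_abs_L2[OF square_integrable_Re_Im(1)[OF f]]
      inner_abs_L2[OF square_integrable_Re_Im(2)[OF f]]
    by simp
qed

lemma integral_operator_rep:
  "integral_operator k h = abs_L2 (\<lambda>x. LINT y|unit_cube. rep_L2 k (x, y) * complex_of_real (rep_L2 h y))"
  using integral_operator.abs_eq[OF L2_rel_self L2_rel_self, of "rep_L2 k" "rep_L2 h"]
  by (simp add: abs_rep_L2 square_integrable_rep_L2)

text \<open>After exchanging the finite sum with the integral, the integrand at \<open>x\<close> is
  bounded by the squared norm of the section of the kernel at \<open>x\<close>; Fubini turns the
  integral of these into the norm of \<open>k\<close>. The bound is uniform in \<open>F\<close>, so
  it extends to a whole basis.\<close>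

lemma sum_norm_integral_operator_le:
  assumes F: "finite F" "pairwise orthogonal F" "\<And>e. e \<in> F \<Longrightarrow> norm e = 1"
  shows "(\<Sum>e\<in>F. (norm (integral_operator k e))\<^sup>2) \<le> (norm k)\<^sup>2"
proof -
  define \<kappa> where "\<kappa> = rep_L2 k"
  have \<kappa>: "square_integrable \<kappa>" unfolding \<kappa>_def by (rule square_integrable_rep_L2)
  have int: "integrable (unit_cube \<Otimes>\<^sub>M unit_cube) (\<lambda>z. (norm (\<kappa> z))\<^sup>2)"
    using \<kappa> by (simp add: square_integrable_def unit_cube_prod)
  define K where "K e x = (LINT y|unit_cube. \<kappa> (x, y) * complex_of_real (rep_L2 e y))" for e x
  have K: "square_integrable (K e)" for e
    unfolding K_def by (intro square_integrable_integral_operator \<kappa> square_integrable_rep_L2)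
  then have Kint: "integrable unit_cube (\<lambda>x. (norm (K e x))\<^sup>2)" for e
    by (simp add: square_integrable_def)
  have "(\<Sum>e\<in>F. (norm (integral_operator k e))\<^sup>2) = (\<Sum>e\<in>F. (LINT x|unit_cube. (norm (K e x))\<^sup>2))"
    using norm_abs_L2_sq[OF K] by (simp add: integral_operator_rep \<kappa>_def[symmetric] K_def[symmetric])
  also have "\<dots> = (LINT x|unit_cube. (\<Sum>e\<in>F. (norm (K e x))\<^sup>2))"
    using Kint by (simp add: Bochner_Integration.integral_sum)
  also have "\<dots> \<le> (LINT x|unit_cube. LINT y|unit_cube. (norm (\<kappa> (x, y)))\<^sup>2)"
  proof (rule integral_mono_AE)
    show "integrable unit_cube (\<lambda>x. \<Sum>e\<in>F. (norm (K e x))\<^sup>2)" using Kint by simp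
    show "integrable unit_cube (\<lambda>x. LINT y|unit_cube. (norm (\<kappa> (x, y)))\<^sup>2)"
      using pair_sigma_finite.integrable_fst'[OF pair_sigma_finite_unit_cube int] by simp
    show "AE x in unit_cube. (\<Sum>e\<in>F. (norm (K e x))\<^sup>2) \<le> (LINT y|unit_cube. (norm (\<kappa> (x, y)))\<^sup>2)"
      using square_integrable_section[OF \<kappa>]
    proof eventually_elim
      case (elim x)
      \<comment> \<open>The inner product of \<^typ>\<open>('a, complex) L2\<close> is only the real part of the Hermitian one, so
        Bessel's inequality is applied to the real and imaginary parts separately.\<close>
      note RI = square_integrable_Re_Im[OF elim]
      have "(\<Sum>e\<in>F. (norm (K e x))\<^sup>2) = (\<Sum>e\<in>F. (abs_L2 (\<lambda>y. Re (\<kappa> (x, y))) \<bullet> e)\<^sup>2)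
          + (\<Sum>e\<in>F. (abs_L2 (\<lambda>y. Im (\<kappa> (x, y))) \<bullet> e)\<^sup>2)"
        unfolding K_def norm_integral_mult_of_real[OF elim] by (rule sum.distrib)
      also have "\<dots> \<le> (norm (abs_L2 (\<lambda>y. Re (\<kappa> (x, y)))))\<^sup>2 + (norm (abs_L2 (\<lambda>y. Im (\<kappa> (x, y)))))\<^sup>2"
        by (intro add_mono Bessel_inequality_finite F)
      also have "\<dots> = (LINT y|unit_cube. (norm (Re (\<kappa> (x, y))))\<^sup>2 + (norm (Im (\<kappa> (x, y))))\<^sup>2)"
        using RI unfolding norm_abs_L2_sq[OF RI(1)] norm_abs_L2_sq[OF RI(2)]
        by (intro Bochner_Integration.integral_add[symmetric]) (simp_all add: square_integrable_def)
      finally show ?case by (simp add: cmod_power2)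
    qed
  qed
  also have "\<dots> = (LINT z|(unit_cube \<Otimes>\<^sub>M unit_cube). (norm (\<kappa> z))\<^sup>2)"
    by (rule pair_sigma_finite.integral_fst'[OF pair_sigma_finite_unit_cube int])
  also have "\<dots> = (norm k)\<^sup>2"
    by (simp add: unit_cube_prod norm_L2_sq \<kappa>_def)
  finally show ?thesis .
qed

lemma norm_integral_operator_le_unit: "norm e = 1 \<Longrightarrow> norm (integral_operator k e) \<le> norm k"
  using sum_norm_integral_operator_le[of "{e}" k] by (simp add: pairwise_def)

text \<open>Additivity of the inner integral needs integrability, which is available when both
  sections at \<open>x\<close> are square integrable. That is so for almost every \<open>x\<close>,
  enough for equality of classes.\<close>

lemma integral_operator_add_left:
  "integral_operator (k + l) h = integral_operator k h + integral_operator l h"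
proof transfer
  fix k l :: "real \<times> real \<Rightarrow> complex" and h :: "real \<Rightarrow> real"
  assume "L2_rel k k" "L2_rel l l" "L2_rel h h"
  then have *: "square_integrable k" "square_integrable l" "square_integrable h"
    by (auto simp: L2_rel_def)
  show "L2_rel (\<lambda>x. LINT y|unit_cube. (k (x, y) + l (x, y)) * complex_of_real (h y))
     (\<lambda>x. (LINT y|unit_cube. k (x, y) * complex_of_real (h y))
        + (LINT y|unit_cube. l (x, y) * complex_of_real (h y)))"
    unfolding L2_rel_def
  proof (intro conjI)
    show "AE x in unit_cube. (LINT y|unit_cube. (k (x, y) + l (x, y)) * complex_of_real (h y)) =
      (LINT y|unit_cube. k (x, y) * complex_of_real (h y))
        + (LINT y|unit_cube. l (x, y) * complex_of_real (h y))"
      using square_integrable_section[OF *(1)] square_integrable_section[OF *(2)]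
      by eventually_elim
        (simp add: distrib_right Bochner_Integration.integral_add integrable_mult_of_real *(3))
  qed (use * in \<open>auto intro!: square_integrable_add square_integrable_integral_operator\<close>)
qed

lemma integral_operator_add_right:
  "integral_operator k (g + h) = integral_operator k g + integral_operator k h"
proof transfer
  fix k :: "real \<times> real \<Rightarrow> complex" and g h :: "real \<Rightarrow> real"
  assume "L2_rel k k" "L2_rel g g" "L2_rel h h"
  then have *: "square_integrable k" "square_integrable g" "square_integrable h"
    by (auto simp: L2_rel_def)
  show "L2_rel (\<lambda>x. LINT y|unit_cube. k (x, y) * complex_of_real (g y + h y))
     (\<lambda>x. (LINT y|unit_cube. k (x, y) * complex_of_real (g y))
        + (LINT y|unit_cube. k (x, y) * complex_of_real (h y)))"
    unfolding L2_rel_def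
  proof (intro conjI)
    show "AE x in unit_cube. (LINT y|unit_cube. k (x, y) * complex_of_real (g y + h y)) =
      (LINT y|unit_cube. k (x, y) * complex_of_real (g y))
        + (LINT y|unit_cube. k (x, y) * complex_of_real (h y))"
      using square_integrable_section[OF *(1)]
      by eventually_elim
        (simp add: distrib_left Bochner_Integration.integral_add integrable_mult_of_real *)
  qed (use * in \<open>auto intro!: square_integrable_add square_integrable_integral_operator simp del: of_real_add\<close>)
qed

lemma integral_operator_scaleR_left:
  "integral_operator (c *\<^sub>R k) h = c *\<^sub>R integral_operator k h"
  by transfer
    (auto simp: L2_rel_def intro!: square_integrable_scaleR square_integrable_integral_operator)

lemma integral_operator_scaleR_right:
  "integral_operator k (c *\<^sub>R h) = c *\<^sub>R integral_operator k h"
proof transfer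
  fix k :: "real \<times> real \<Rightarrow> complex" and h :: "real \<Rightarrow> real" and c :: real
  assume *: "L2_rel k k" "L2_rel h h"
  \<comment> \<open>This holds at every \<open>x\<close>: where the product is not integrable, its
    integral is 0 by convention and both sides vanish.\<close>
  have "(LINT y|unit_cube. k (x, y) * complex_of_real (c *\<^sub>R h y)) =
      c *\<^sub>R (LINT y|unit_cube. k (x, y) * complex_of_real (h y))" for x
  proof -
    have "(LINT y|unit_cube. k (x, y) * complex_of_real (c *\<^sub>R h y)) =
        (LINT y|unit_cube. c *\<^sub>R (k (x, y) * complex_of_real (h y)))"
      by (rule Bochner_Integration.integral_cong) (auto simp: scaleR_conv_of_real)
    then show ?thesis by simp
  qed
  with * show "L2_rel (\<lambda>x. LINT y|unit_cube. k (x, y) * complex_of_real (c *\<^sub>R h y))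
     (\<lambda>x. c *\<^sub>R (LINT y|unit_cube. k (x, y) * complex_of_real (h y)))"
    by (simp add: L2_rel_def square_integrable_scaleR square_integrable_integral_operator)
qed

lemma bounded_bilinear_integral_operator: "bounded_bilinear integral_operator"
proof
  show "\<exists>K. \<forall>k h. norm (integral_operator k h) \<le> norm k * norm h * K"
  proof (intro exI allI)
    fix k :: "(real \<times> real, complex) L2" and h :: "(real, real) L2"
    show "norm (integral_operator k h) \<le> norm k * norm h * 1"
    \<comment> \<open>Homogeneity reduces the bound to the unit vector \<open>sgn h\<close>, which
      exists only for nonzero \<open>h\<close>.\<close>
    proof (cases "h = 0")
      case True
      then show ?thesis using integral_operator_scaleR_right[of k 0 h] by simp
    next
      case False
      then have "norm (integral_operator k h) = norm h * norm (integral_operator k (sgn h))"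
        by (simp add: sgn_div_norm integral_operator_scaleR_right)
      also have "\<dots> \<le> norm h * norm k"
        using False by (intro mult_left_mono norm_integral_operator_le_unit) (auto simp: norm_sgn)
      finally show ?thesis by (simp add: mult.commute)
    qed
  qed
qed (rule integral_operator_add_left integral_operator_add_right
    integral_operator_scaleR_left integral_operator_scaleR_right)+

section \<open>Hilbert-Schmidt sums and pairings of integral operators\<close>

lemma
  assumes B: "orthonormal_basis B"
  shows summable_on_integral_operator: "(\<lambda>e. (norm (integral_operator k e))\<^sup>2) summable_on B"
    and infsum_integral_operator_le: "(\<Sum>\<^sub>\<infinity>e\<in>B. (norm (integral_operator k e))\<^sup>2) \<le> (norm k)\<^sup>2"
proof -
  have le: "(\<Sum>e\<in>F. (norm (integral_operator k e))\<^sup>2) \<le> (norm k)\<^sup>2" if "finite F" "F \<subseteq> B" for F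
    using that B
    by (intro sum_norm_integral_operator_le) (auto simp: orthonormal_basis_def intro: pairwise_subset)
  show s: "(\<lambda>e. (norm (integral_operator k e))\<^sup>2) summable_on B"
  proof (rule nonneg_bdd_above_summable_on)
    show "bdd_above (sum (\<lambda>e. (norm (integral_operator k e))\<^sup>2) ` {F. F \<subseteq> B \<and> finite F})"
      using le by (intro bdd_aboveI2) auto
  qed simp
  show "(\<Sum>\<^sub>\<infinity>e\<in>B. (norm (integral_operator k e))\<^sup>2) \<le> (norm k)\<^sup>2"
    by (rule infsum_le_finite_sums[OF s le])
qed

lemma hilbert_schmidt_integral_operator: "hilbert_schmidt (integral_operator k)"
  unfolding hilbert_schmidt_def
  using bounded_bilinear.bounded_linear_right[OF bounded_bilinear_integral_operator]
    summable_on_integral_operator by blast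

text \<open>This yields continuity of the squared Hilbert-Schmidt norm as a function of the kernel,
  hence integrability over frequencies.\<close>

lemma bounded_bilinear_hs_inner:
  assumes B: "orthonormal_basis B"
  shows "bounded_bilinear (\<lambda>k l. \<Sum>\<^sub>\<infinity>e\<in>B. integral_operator k e \<bullet> integral_operator l e)"
proof -
  note s = summable_on_inner[OF summable_on_integral_operator[OF B] summable_on_integral_operator[OF B]]
  show ?thesis
  proof
    show "\<exists>K. \<forall>k l. norm (\<Sum>\<^sub>\<infinity>e\<in>B. integral_operator k e \<bullet> integral_operator l e) \<le> norm k * norm l * K"
    proof (intro exI allI)
      fix k l
      have "sqrt (\<Sum>\<^sub>\<infinity>e\<in>B. (norm (integral_operator k e))\<^sup>2) \<le> norm k" for k
        using infsum_integral_operator_le[OF B, of k] by (rule real_le_lsqrt[rotated]) simp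
      then show "norm (\<Sum>\<^sub>\<infinity>e\<in>B. integral_operator k e \<bullet> integral_operator l e) \<le> norm k * norm l * 1"
        unfolding real_norm_def mult_1_right
        by (intro order_trans[OF infsum_inner_le] mult_mono summable_on_integral_operator B)
          (auto intro: infsum_nonneg)
    qed
  qed (simp_all add: integral_operator_add_left integral_operator_scaleR_left inner_add_left
      inner_add_right infsum_add[OF s s] infsum_cmult_right')
qed

text \<open>Here \<open>D\<close> need not come from a kernel, so that an arbitrary Hilbert-Schmidt
  operator can be compared with the integral operators. By Cauchy-Schwarz, the square root of the
  sum of \<open>(norm (D e))\<^sup>2\<close> bounds the functional.\<close>

lemma bounded_linear_hs_inner:
  assumes B: "orthonormal_basis B" and D: "(\<lambda>e. (norm (D e))\<^sup>2) summable_on B"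
  shows "bounded_linear (\<lambda>k. \<Sum>\<^sub>\<infinity>e\<in>B. integral_operator k e \<bullet> D e)"
proof (rule bounded_linear_intro)
  note s = summable_on_inner[OF summable_on_integral_operator[OF B] D]
  fix k l :: "(real \<times> real, complex) L2" and c :: real
  show "(\<Sum>\<^sub>\<infinity>e\<in>B. integral_operator (k + l) e \<bullet> D e)
      = (\<Sum>\<^sub>\<infinity>e\<in>B. integral_operator k e \<bullet> D e) + (\<Sum>\<^sub>\<infinity>e\<in>B. integral_operator l e \<bullet> D e)"
    by (simp add: integral_operator_add_left inner_add_left infsum_add[OF s s])
  show "(\<Sum>\<^sub>\<infinity>e\<in>B. integral_operator (c *\<^sub>R k) e \<bullet> D e) = c *\<^sub>R (\<Sum>\<^sub>\<infinity>e\<in>B. integral_operator k e \<bullet> D e)"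
    by (simp add: integral_operator_scaleR_left infsum_cmult_right')
  have "sqrt (\<Sum>\<^sub>\<infinity>e\<in>B. (norm (integral_operator k e))\<^sup>2) \<le> norm k"
    using infsum_integral_operator_le[OF B, of k] by (rule real_le_lsqrt[rotated]) simp
  then have "sqrt (\<Sum>\<^sub>\<infinity>e\<in>B. (norm (integral_operator k e))\<^sup>2) * sqrt (\<Sum>\<^sub>\<infinity>e\<in>B. (norm (D e))\<^sup>2)
      \<le> norm k * sqrt (\<Sum>\<^sub>\<infinity>e\<in>B. (norm (D e))\<^sup>2)"
    by (rule mult_right_mono) (auto intro: infsum_nonneg)
  with infsum_inner_le[OF summable_on_integral_operator[OF B] D, of k]
  show "norm (\<Sum>\<^sub>\<infinity>e\<in>B. integral_operator k e \<bullet> D e) \<le> norm k * sqrt (\<Sum>\<^sub>\<infinity>e\<in>B. (norm (D e))\<^sup>2)"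
    unfolding real_norm_def by (rule order_trans)
qed

section \<open>The spectral density kernel\<close>

lemma norm_cscale: "norm (cscale c f) = cmod c * norm f"
  by transfer (simp add: norm_mult power_mult_distrib real_sqrt_mult)

lemma bounded_linear_cscale: "bounded_linear (\<lambda>c. cscale c f)"
proof (rule bounded_linear_intro)
  fix b c :: complex and r :: real
  have si: "square_integrable (\<lambda>x. c * complex_of_real (f x))"
    if "square_integrable f" for c and f :: "'a \<Rightarrow> real"
    using that by (auto simp: square_integrable_def norm_mult power_mult_distrib)
  show "cscale (b + c) f = cscale b f + cscale c f"
    by transfer (auto simp: L2_rel_def distrib_right intro!: square_integrable_add si)
  show "cscale (r *\<^sub>R c) f = r *\<^sub>R cscale c f"
    by transfer (auto simp: L2_rel_def intro!: square_integrable_scaleR si)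
  show "norm (cscale c f) \<le> norm c * norm f" by (simp add: norm_cscale)
qed

text \<open>The exponential factors have modulus 1, so the norms of the autocovariance kernels are a
  majorant independent of \<omega>. The Weierstrass M-test makes the series a uniform limit of
  continuous finite sums.\<close>

lemma continuous_on_spectral_density_kernel:
  assumes "(\<lambda>t. norm (autocov_kernel M X t)) summable_on UNIV"
  shows "continuous_on S (spectral_density_kernel M X)"
proof -
  let ?g = "\<lambda>t \<omega>. cscale (exp (- \<i> * \<omega> * of_int t)) (autocov_kernel M X t)"
  have ul: "uniform_limit S (\<lambda>T \<omega>. \<Sum>t\<in>T. ?g t \<omega>) (\<lambda>\<omega>. \<Sum>\<^sub>\<infinity>t\<in>UNIV. ?g t \<omega>)
      (finite_subsets_at_top UNIV)"
  proof (rule Weierstrass_m_test_general[OF _ assms])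
    fix t :: int and \<omega> :: real
    have "cmod (exp (- \<i> * \<omega> * of_int t)) = 1" by (simp add: norm_exp_eq_Re)
    then show "norm (?g t \<omega>) \<le> norm (autocov_kernel M X t)" by (simp add: norm_cscale)
  qed
  have ev: "\<forall>\<^sub>F T in finite_subsets_at_top UNIV. continuous_on S (\<lambda>\<omega>. \<Sum>t\<in>T. ?g t \<omega>)"
    by (intro always_eventually allI continuous_on_sum
        bounded_linear.continuous_on[OF bounded_linear_cscale] continuous_intros)
  have "continuous_on S (\<lambda>\<omega>. \<Sum>\<^sub>\<infinity>t\<in>UNIV. ?g t \<omega>)"
    using uniform_limit_theorem[OF ev ul] by simp
  then show ?thesis
    unfolding spectral_density_kernel_def by (intro continuous_intros)
qed

section \<open>The decomposition of the integrated distance and the minimizer\<close>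

lemma hs_norm_sq:
  "(hs_norm A)\<^sup>2 = (\<Sum>\<^sub>\<infinity>e\<in>(SOME B. orthonormal_basis B). (norm (A e))\<^sup>2)"
  by (simp add: hs_norm_def infsum_nonneg)

text \<open>The first summand is kept as a value of the functional being minimized, so that
  minimality can be read off from the sign of the second.\<close>

lemma integrated_hs_distance_sq_decomp:
  assumes sm: "(\<lambda>t. norm (autocov_kernel M X t)) summable_on UNIV"
    and F: "hilbert_schmidt F"
  shows "integrated_hs_distance_sq M X F =
      integrated_hs_distance_sq M X (mean_spectral_operator M X)
      + integral {- pi..pi} (\<lambda>\<omega>. (hs_norm (\<lambda>h. mean_spectral_operator M X h - F h))\<^sup>2)"
proof -
  define B :: "(real, real) L2 set" where "B = (SOME B. orthonormal_basis B)"
  have B: "orthonormal_basis B"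
    unfolding B_def by (rule someI_ex[OF orthonormal_basis_exists])
  \<comment> \<open>Fixing the types identifies the basis chosen inside \<open>hs_norm\<close> with
    \<open>B\<close>, so all norms below are sums over the same basis.\<close>
  note hs = hs_norm_sq[where 'a = "(real, real) L2" and 'b = "(real, complex) L2", folded B_def]
  define f where "f = spectral_density_kernel M X"
  define m where "m = mean_spectral_kernel M X"
  define D where "D h = integral_operator m h - F h" for h
  have F_sm: "(\<lambda>e. (norm (F e))\<^sup>2) summable_on B"
    using F B by (simp add: hilbert_schmidt_def)
  have D_sm: "(\<lambda>e. (norm (D e))\<^sup>2) summable_on B"
    using summable_on_norm_add_sq[OF summable_on_integral_operator[OF B, of m], of "\<lambda>e. - F e"] F_sm
    by (simp add: D_def)
  have diff: "integral_operator (k - l) h = integral_operator k h - integral_operator l h" for k l h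
    by (rule bounded_bilinear.diff_left[OF bounded_bilinear_integral_operator])
  \<comment> \<open>Inner products replace squared norms here so that
    \<open>bounded_bilinear_hs_inner\<close> applies and gives continuity in \<omega>.\<close>
  define Q where "Q \<omega> = (\<Sum>\<^sub>\<infinity>e\<in>B. integral_operator (f \<omega> - m) e \<bullet> integral_operator (f \<omega> - m) e)" for \<omega>
  define T where "T k = (\<Sum>\<^sub>\<infinity>e\<in>B. integral_operator k e \<bullet> D e)" for k
  have T: "bounded_linear T" unfolding T_def by (rule bounded_linear_hs_inner[OF B D_sm])
  have Q: "(hs_norm (\<lambda>h. spectral_density_operator M X \<omega> h - mean_spectral_operator M X h))\<^sup>2 = Q \<omega>" for \<omega>
    by (simp add: hs Q_def spectral_density_operator_def mean_spectral_operator_def f_def m_def diff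
        power2_norm_eq_inner)
  have split: "(hs_norm (\<lambda>h. spectral_density_operator M X \<omega> h - F h))\<^sup>2 = Q \<omega>
      + (hs_norm (\<lambda>h. mean_spectral_operator M X h - F h))\<^sup>2 + 2 * T (f \<omega> - m)" for \<omega>
  proof -
    have "(hs_norm (\<lambda>h. spectral_density_operator M X \<omega> h - F h))\<^sup>2
        = (\<Sum>\<^sub>\<infinity>e\<in>B. (norm (integral_operator (f \<omega> - m) e + D e))\<^sup>2)"
      by (simp add: hs spectral_density_operator_def D_def diff f_def)
    also have "\<dots> = (\<Sum>\<^sub>\<infinity>e\<in>B. (norm (integral_operator (f \<omega> - m) e))\<^sup>2)
        + (\<Sum>\<^sub>\<infinity>e\<in>B. (norm (D e))\<^sup>2) + 2 * T (f \<omega> - m)"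
      unfolding T_def by (rule infsum_norm_add_sq[OF summable_on_integral_operator[OF B] D_sm])
    also have "(\<Sum>\<^sub>\<infinity>e\<in>B. (norm (D e))\<^sup>2) = (hs_norm (\<lambda>h. mean_spectral_operator M X h - F h))\<^sup>2"
      by (simp add: hs D_def mean_spectral_operator_def m_def)
    also have "(\<Sum>\<^sub>\<infinity>e\<in>B. (norm (integral_operator (f \<omega> - m) e))\<^sup>2) = Q \<omega>"
      by (simp add: Q_def power2_norm_eq_inner)
    finally show ?thesis .
  qed
  have cont: "continuous_on {- pi..pi} (\<lambda>\<omega>. f \<omega> - m)"
    unfolding f_def by (intro continuous_intros continuous_on_spectral_density_kernel[OF sm])
  then have int: "(\<lambda>\<omega>. f \<omega> - m) integrable_on {- pi..pi}"
    by (rule integrable_continuous_real)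
  have "continuous_on {- pi..pi} Q"
    unfolding Q_def
    by (rule bounded_bilinear.continuous_on[OF bounded_bilinear_hs_inner[OF B] cont cont])
  then have Q_int: "Q integrable_on {- pi..pi}" by (rule integrable_continuous_real)
  have "integral {- pi..pi} (\<lambda>\<omega>. f \<omega> - m) = integral {- pi..pi} f - integral {- pi..pi} (\<lambda>_. m)"
    unfolding f_def
    by (intro Henstock_Kurzweil_Integration.integral_diff integrable_continuous_real
        continuous_on_spectral_density_kernel[OF sm] continuous_on_const)
  \<comment> \<open>The interval has length \<open>2 * pi\<close> and \<open>m\<close> is the
    average of \<open>f\<close> over it.\<close>
  also have "\<dots> = 0"
    by (simp add: m_def mean_spectral_kernel_def f_def)
  \<comment> \<open>The bounded linear functional \<open>T\<close> moves outside the integral and is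
    evaluated at 0.\<close>
  finally have "integral {- pi..pi} (T \<circ> (\<lambda>\<omega>. f \<omega> - m)) = 0"
    using integral_linear[OF int T] by (simp add: linear_0[OF bounded_linear.linear[OF T]])
  then have T0: "integral {- pi..pi} (\<lambda>\<omega>. 2 * T (f \<omega> - m)) = 0"
    by (simp add: o_def)
  have T_int: "(\<lambda>\<omega>. 2 * T (f \<omega> - m)) integrable_on {- pi..pi}"
    using integrable_linear[OF int T] by (intro integrable_on_mult_right) (simp add: o_def)
  show ?thesis
    unfolding integrated_hs_distance_sq_def split Q
    using Henstock_Kurzweil_Integration.integral_add[OF integrable_add[OF Q_int integrable_const_ivl] T_int]
      Henstock_Kurzweil_Integration.integral_add[OF Q_int integrable_const_ivl]
    unfolding T0 by simp
qed

theorem theorem3p1: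
  fixes M :: "'w measure" and X :: "int \<Rightarrow> 'w \<Rightarrow> (real, real) L2"
  assumes "prob_space M"
    and "strictly_stationary M X"
    and "integrable M (\<lambda>w. (norm (X 0 w))\<^sup>2)"
    and "(\<lambda>t. norm (autocov_kernel M X t)) summable_on UNIV"
  shows "(\<forall>F. hilbert_schmidt F \<longrightarrow>
        integrated_hs_distance_sq M X F =
          integral {- pi..pi} (\<lambda>\<omega>. (hs_norm (\<lambda>h.
            spectral_density_operator M X \<omega> h - mean_spectral_operator M X h))\<^sup>2)
          + integral {- pi..pi} (\<lambda>\<omega>. (hs_norm (\<lambda>h. mean_spectral_operator M X h - F h))\<^sup>2))
    \<and> is_arg_min (integrated_hs_distance_sq M X) hilbert_schmidt (mean_spectral_operator M X)"
proof
  note decomp = integrated_hs_distance_sq_decomp[OF assms(4)]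
  show "\<forall>F. hilbert_schmidt F \<longrightarrow>
        integrated_hs_distance_sq M X F =
          integral {- pi..pi} (\<lambda>\<omega>. (hs_norm (\<lambda>h.
            spectral_density_operator M X \<omega> h - mean_spectral_operator M X h))\<^sup>2)
          + integral {- pi..pi} (\<lambda>\<omega>. (hs_norm (\<lambda>h. mean_spectral_operator M X h - F h))\<^sup>2)"
    using decomp by (simp add: integrated_hs_distance_sq_def)
  have "hilbert_schmidt (mean_spectral_operator M X)"
    unfolding mean_spectral_operator_def by (rule hilbert_schmidt_integral_operator)
  \<comment> \<open>The excess is the integral of a square that is constant in \<omega>, hence
    nonnegative.\<close>
  moreover have "integrated_hs_distance_sq M X (mean_spectral_operator M X)
      \<le> integrated_hs_distance_sq M X F" if "hilbert_schmidt F" for F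
    unfolding decomp[OF that] by simp
  ultimately show "is_arg_min (integrated_hs_distance_sq M X) hilbert_schmidt (mean_spectral_operator M X)"
    by (auto simp: is_arg_min_def not_less)
qed

end
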